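(* Let $X$ and $Y$ be uniformly locally finite metric spaces and assume that all the sparse subspaces of $Y$ yield only compact ghost projections. If $\mathrm{C}^*_u(X)$ embeds into $\mathrm{C}^*_u(Y)$ by a rank preserving map, then there exists a uniformly finite-to-one coarse map $X\to Y$.
   Context: A metric space $(X,d)$ is uniformly locally finite (u.l.f.) if $\sup_{x\in X}|B_r(x)|<\infty$ for all $r>0$. Let $(\delta_x)_{x\in X}$ be the canonical basis of $\ell_2(X)$. An operator $a\in\mathcal{B}(\ell_2(X))$ has finite propagation if there is $r>0$ with $\langle a\delta_x,\delta_y\rangle=0$ whenever $d(x,y)>r$. The uniform Roe algebra $\mathrm{C}^*_u(X)$ is the norm closure in $\mathcal{B}(\ell_2(X))$ of the finite propagation operators. An operator $a\in\mathcal{B}(\ell_2(X))$ is a ghost if for all $\varepsilon>0$ there is a finite $A\subseteq X$ such that $|\langle a\delta_x,\delta_y\rangle|<\varepsilon$ for all $x,y\in X\setminus A$. The space $X$ yields only compact ghost projections if every ghost projection in $\mathrm{C}^*_u(X)$ is compact. The space $X$ is sparse if there is a partition $X=\bigsqcup_{n\in\mathbb{N}}X_n$ into finite subsets with $d(X_n,X_m)\to\infty$ as $n+m\to\infty$ ($n\neq m$). A sparse subspace of $Y$ is a subset of $Y$ which is sparse in the restricted metric. An embedding is an injective $^*$-homomorphism (not necessarily unital). A map $\Phi\colon\mathrm{C}^*_u(X)\to\mathrm{C}^*_u(Y)$ is rank preserving if it sends minimal (i.e. rank $1$) projections to minimal (rank $1$) projections. A map $f\colon(X,d)\to(Y,\partial)$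 is coarse if $\sup\{\partial(f(x),f(y))\mid d(x,y)\leq r\}<\infty$ for all $r>0$, and uniformly finite-to-one if $\sup_{y\in Y}|f^{-1}(\{y\})|<\infty$. *)

theory Defs
  imports "HOL-Analysis.Analysis"
begin

section \<open>The complex Hilbert space of square-summable functions\<close>

typedef 'a ell2 = "{f :: 'a \<Rightarrow> complex. (\<lambda>x. (cmod (f x))\<^sup>2) summable_on UNIV}"
  morphisms coord Abs_ell2
  by (rule exI[of _ "\<lambda>_. 0"]) simp

setup_lifting type_definition_ell2

lemma ell2_eqI: "(\<And>x. coord f x = coord g x) \<Longrightarrow> f = g"
  by (simp add: coord_inject[symmetric] ext)

lemma summable_coord_square: "(\<lambda>x. (cmod (coord f x))\<^sup>2) summable_on A"
  using coord[of f] summable_on_subset_banach by fastforce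

lemma summable_coord_mult: "(\<lambda>x. coord f x * cnj (coord g x)) summable_on A"
proof (rule abs_summable_summable, rule abs_summable_product)
  show "(\<lambda>x. norm (coord f x * coord f x)) summable_on A"
    using summable_coord_square[of f A] by (simp add: norm_mult power2_eq_square)
  show "(\<lambda>x. norm (cnj (coord g x) * cnj (coord g x))) summable_on A"
    using summable_coord_square[of g A] by (simp add: norm_mult power2_eq_square)
qed

lemma square_summable_add:
  fixes f g :: "'a \<Rightarrow> complex"
  assumes "(\<lambda>x. (cmod (f x))\<^sup>2) summable_on A" "(\<lambda>x. (cmod (g x))\<^sup>2) summable_on A"
  shows "(\<lambda>x. (cmod (f x + g x))\<^sup>2) summable_on A"
proof -
  have sum: "(\<lambda>x. 2 * (cmod (f x))\<^sup>2 + 2 * (cmod (g x))\<^sup>2) summable_on A"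
    using assms by (intro summable_on_add summable_on_cmult_right)
  have le: "(cmod (a + b))\<^sup>2 \<le> 2 * (cmod a)\<^sup>2 + 2 * (cmod b)\<^sup>2" for a b :: complex
  proof -
    have "(cmod (a + b))\<^sup>2 \<le> (cmod a + cmod b)\<^sup>2"
      by (simp add: norm_triangle_ineq power_mono)
    also have "\<dots> \<le> 2 * (cmod a)\<^sup>2 + 2 * (cmod b)\<^sup>2"
      using sum_squares_bound[of "cmod a" "cmod b"] by (simp add: power2_sum)
    finally show ?thesis .
  qed
  show ?thesis
    by (rule summable_on_comparison_test[OF sum]) (auto intro: le)
qed

instantiation ell2 :: (type) real_vector
begin

lift_definition zero_ell2 :: "'a ell2" is "\<lambda>_. 0" by simp

lift_definition plus_ell2 :: "'a ell2 \<Rightarrow> 'a ell2 \<Rightarrow> 'a ell2" is "\<lambda>f g x. f x + g x"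
  by (simp add: square_summable_add)

lift_definition uminus_ell2 :: "'a ell2 \<Rightarrow> 'a ell2" is "\<lambda>f x. - f x" by simp

lift_definition minus_ell2 :: "'a ell2 \<Rightarrow> 'a ell2 \<Rightarrow> 'a ell2" is "\<lambda>f g x. f x - g x"
  using square_summable_add[of _ UNIV "\<lambda>x. - _ x"] by simp

lift_definition scaleR_ell2 :: "real \<Rightarrow> 'a ell2 \<Rightarrow> 'a ell2" is "\<lambda>r f x. of_real r * f x"
  by (simp add: norm_mult power_mult_distrib summable_on_cmult_right)

instance
  by standard (transfer; force simp: algebra_simps)+

end

lift_definition scaleC :: "complex \<Rightarrow> 'a ell2 \<Rightarrow> 'a ell2"  (infixr "*\<^sub>C" 75) is "\<lambda>c f x. c * f x"
  by (simp add: norm_mult power_mult_distrib summable_on_cmult_right)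

lift_definition delta :: "'a \<Rightarrow> 'a ell2" is "\<lambda>x y. if y = x then 1 else 0"
  by (rule finite_nonzero_values_imp_summable_on) (auto simp: if_distrib cong: if_cong)

text \<open>The inner product is linear in its first argument.\<close>

definition cinner :: "'a ell2 \<Rightarrow> 'a ell2 \<Rightarrow> complex" where
  "cinner f g = (\<Sum>\<^sub>\<infinity>x. coord f x * cnj (coord g x))"

lemma coord_simps [simp]:
  "coord 0 x = 0" "coord (f + g) x = coord f x + coord g x" "coord (- f) x = - coord f x"
  "coord (f - g) x = coord f x - coord g x" "coord (r *\<^sub>R f) x = of_real r * coord f x"
  "coord (c *\<^sub>C f) x = c * coord f x" "coord (delta y) x = (if x = y then 1 else 0)"
  by (transfer; simp)+

lemma cinner_add_left: "cinner (f + g) h = cinner f h + cinner g h"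
  unfolding cinner_def by (simp add: distrib_right infsum_add summable_coord_mult)

lemma cinner_scaleC_left: "cinner (c *\<^sub>C f) g = c * cinner f g"
  unfolding cinner_def by (simp add: mult.assoc infsum_cmult_right')

lemma cinner_commute: "cinner f g = cnj (cinner g f)"
  unfolding cinner_def by (simp add: mult.commute flip: infsum_cnj)

lemma scaleR_scaleC: "r *\<^sub>R f = of_real r *\<^sub>C f" for f :: "'a ell2"
  by (rule ell2_eqI) simp

lemma cinner_same: "cinner f f = of_real (\<Sum>\<^sub>\<infinity>x. (cmod (coord f x))\<^sup>2)"
proof -
  have "(\<Sum>\<^sub>\<infinity>x. complex_of_real ((cmod (coord f x))\<^sup>2))
      = of_real (\<Sum>\<^sub>\<infinity>x. (cmod (coord f x))\<^sup>2)"
    by (rule infsumI, rule has_sum_of_real, rule has_sum_infsum, rule summable_coord_square)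
  thus ?thesis unfolding cinner_def complex_norm_square .
qed

lemma cinner_same_eq_0: "cinner f f = 0 \<longleftrightarrow> f = 0"
proof
  assume "cinner f f = 0"
  hence "(\<Sum>\<^sub>\<infinity>x. (cmod (coord f x))\<^sup>2) = 0" by (simp add: cinner_same)
  hence "(cmod (coord f x))\<^sup>2 = 0" for x
    using nonneg_infsum_le_0D[OF _ summable_coord_square, of f UNIV x] by simp
  thus "f = 0" by (intro ell2_eqI) simp
qed (simp add: cinner_def)

text \<open>The Hilbert norm, obtained from the real inner product \<open>Re \<langle>f, g\<rangle>\<close>.\<close>

instantiation ell2 :: (type) real_inner
begin

definition inner_ell2 :: "'a ell2 \<Rightarrow> 'a ell2 \<Rightarrow> real" where
  "inner_ell2 f g = Re (cinner f g)"
definition norm_ell2 :: "'a ell2 \<Rightarrow> real" where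
  "norm_ell2 f = sqrt (inner f f)"
definition dist_ell2 :: "'a ell2 \<Rightarrow> 'a ell2 \<Rightarrow> real" where
  "dist_ell2 f g = norm (f - g)"
definition sgn_ell2 :: "'a ell2 \<Rightarrow> 'a ell2" where
  "sgn_ell2 f = f /\<^sub>R norm f"
definition uniformity_ell2 :: "('a ell2 \<times> 'a ell2) filter" where
  "uniformity_ell2 = (INF e\<in>{0 <..}. principal {(f, g). dist f g < e})"
definition open_ell2 :: "'a ell2 set \<Rightarrow> bool" where
  "open_ell2 U = (\<forall>f\<in>U. eventually (\<lambda>(f', g). f' = f \<longrightarrow> g \<in> U) uniformity)"

instance
proof
  fix f g h :: "'a ell2" and r :: real
  show "inner f g = inner g f"
    unfolding inner_ell2_def by (subst cinner_commute) simp
  show "inner (f + g) h = inner f h + inner g h"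
    by (simp add: inner_ell2_def cinner_add_left)
  show "inner (r *\<^sub>R f) g = r * inner f g"
    by (simp add: inner_ell2_def scaleR_scaleC cinner_scaleC_left)
  show "0 \<le> inner f f"
    by (simp add: inner_ell2_def cinner_same infsum_nonneg)
  show "inner f f = 0 \<longleftrightarrow> f = 0"
    unfolding cinner_same_eq_0[symmetric] by (simp add: inner_ell2_def cinner_same)
qed (simp_all add: norm_ell2_def dist_ell2_def sgn_ell2_def uniformity_ell2_def open_ell2_def)

end

lemma norm_ell2_square: "(norm f)\<^sup>2 = (\<Sum>\<^sub>\<infinity>x. (cmod (coord f x))\<^sup>2)"
  unfolding power2_norm_eq_inner[of f] by (simp add: inner_ell2_def cinner_same)

lemma norm_scaleC: "norm (c *\<^sub>C f) = cmod c * norm f"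
proof -
  have "(norm (c *\<^sub>C f))\<^sup>2 = (cmod c * norm f)\<^sup>2"
    by (simp add: norm_ell2_square power_mult_distrib norm_mult infsum_cmult_right')
  thus ?thesis by (simp add: power2_eq_iff_nonneg)
qed

lemma bounded_linear_scaleC: "bounded_linear (\<lambda>f. c *\<^sub>C f)"
  by (rule bounded_linear_intro[of _ "cmod c"])
    (auto intro!: ell2_eqI simp: algebra_simps norm_scaleC)

lemma cmod_cinner_le: "cmod (cinner f g) \<le> norm f * norm g"
proof (cases "cinner f g = 0")
  case False
  define c where "c = cnj (sgn (cinner f g))"
  have c: "cmod c = 1" using False by (simp add: c_def norm_sgn)
  have "of_real (cmod (cinner f g)) = c * cinner f g"
    using False by (simp add: c_def sgn_eq complex_norm_square[symmetric] field_simps power2_eq_square)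
  hence "cmod (cinner f g) = inner (c *\<^sub>C f) g"
    by (metis inner_ell2_def cinner_scaleC_left Re_complex_of_real)
  also have "\<dots> \<le> norm (c *\<^sub>C f) * norm g" by (rule norm_cauchy_schwarz)
  finally show ?thesis by (simp add: norm_scaleC c)
qed simp


section \<open>Operators\<close>

text \<open>
  All Hilbert spaces below are of the form \<open>\<ell>\<^sub>2(M)\<close> for a set \<open>M\<close> of points of a type \<open>'a\<close>. We
  identify \<open>\<ell>\<^sub>2(M)\<close> with the functions in \<^typ>\<open>'a ell2\<close> that vanish off \<open>M\<close>, and \<open>B(\<ell>\<^sub>2(M))\<close> with
  the corner of the bounded operators on \<^typ>\<open>'a ell2\<close> consisting of the operators that have range
  in \<open>\<ell>\<^sub>2(M)\<close> and are zero on its orthogonal complement. This identification is an isometric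
  *-isomorphism. The type \<open>\<Rightarrow>\<^sub>L\<close> only enforces real linearity, hence the first conjunct.
\<close>

type_synonym 'a operator = "'a ell2 \<Rightarrow>\<^sub>L 'a ell2"

definition bounded_operators :: "'a set \<Rightarrow> 'a operator set" where
  "bounded_operators M = {a.
     (\<forall>c f. blinfun_apply a (c *\<^sub>C f) = c *\<^sub>C blinfun_apply a f) \<and>
     (\<forall>f. \<forall>x. x \<notin> M \<longrightarrow> coord (blinfun_apply a f) x = 0) \<and>
     (\<forall>f. (\<forall>x\<in>M. coord f x = 0) \<longrightarrow> blinfun_apply a f = 0)}"

definition scaleC_op :: "complex \<Rightarrow> 'a operator \<Rightarrow> 'a operator" where
  "scaleC_op c a = Blinfun (\<lambda>f. c *\<^sub>C blinfun_apply a f)"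

lemma scaleC_op_apply [simp]: "blinfun_apply (scaleC_op c a) f = c *\<^sub>C blinfun_apply a f"
  unfolding scaleC_op_def
  by (simp add: bounded_linear_Blinfun_apply
      bounded_linear_compose[OF bounded_linear_scaleC blinfun.bounded_linear_right])

text \<open>Lemma \<open>cinner_adj\<close> below shows that the adjoint of a complex-linear operator exists.\<close>

definition adj :: "'a operator \<Rightarrow> 'a operator" where
  "adj a = (THE b. \<forall>f g. cinner (blinfun_apply a f) g = cinner f (blinfun_apply b g))"

definition matrix_entry :: "'a operator \<Rightarrow> 'a \<Rightarrow> 'a \<Rightarrow> complex" where
  "matrix_entry a x y = cinner (blinfun_apply a (delta x)) (delta y)"

definition projection :: "'a operator \<Rightarrow> bool" where
  "projection p \<longleftrightarrow> p o\<^sub>L p = p \<and> adj p = p"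

definition rank_one :: "'a operator \<Rightarrow> bool" where
  "rank_one a \<longleftrightarrow> (\<exists>v. v \<noteq> 0 \<and> range (blinfun_apply a) = range (\<lambda>c. c *\<^sub>C v))"

definition compact_operator :: "'a operator \<Rightarrow> bool" where
  "compact_operator a \<longleftrightarrow> compact (closure (blinfun_apply a ` cball 0 1))"


section \<open>Uniform Roe algebras\<close>

definition uniformly_locally_finite :: "'a set \<Rightarrow> ('a \<Rightarrow> 'a \<Rightarrow> real) \<Rightarrow> bool" where
  "uniformly_locally_finite M d \<longleftrightarrow>
     (\<forall>r>0. \<exists>N. \<forall>x\<in>M. finite (Metric_space.mcball M d x r) \<and>
                       card (Metric_space.mcball M d x r) \<le> N)"

definition finite_propagation :: "'a set \<Rightarrow> ('a \<Rightarrow> 'a \<Rightarrow> real) \<Rightarrow> 'a operator \<Rightarrow> bool" where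
  "finite_propagation M d a \<longleftrightarrow>
     (\<exists>r>0. \<forall>x\<in>M. \<forall>y\<in>M. d x y > r \<longrightarrow> matrix_entry a x y = 0)"

definition uniform_Roe_algebra :: "'a set \<Rightarrow> ('a \<Rightarrow> 'a \<Rightarrow> real) \<Rightarrow> 'a operator set" where
  "uniform_Roe_algebra M d = closure {a \<in> bounded_operators M. finite_propagation M d a}"

definition ghost :: "'a set \<Rightarrow> 'a operator \<Rightarrow> bool" where
  "ghost M a \<longleftrightarrow>
     (\<forall>\<epsilon>>0. \<exists>A. finite A \<and> A \<subseteq> M \<and> (\<forall>x\<in>M - A. \<forall>y\<in>M - A. cmod (matrix_entry a x y) < \<epsilon>))"

definition only_compact_ghost_projections :: "'a set \<Rightarrow> ('a \<Rightarrow> 'a \<Rightarrow> real) \<Rightarrow> bool" where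
  "only_compact_ghost_projections M d \<longleftrightarrow>
     (\<forall>p\<in>uniform_Roe_algebra M d. projection p \<and> ghost M p \<longrightarrow> compact_operator p)"

text \<open>
  The last conjunct says that the distance between \<open>P n\<close> and \<open>P m\<close>, with \<open>n \<noteq> m\<close>, tends to infinity
  as \<open>n + m\<close> does. The pieces \<open>P n\<close> may be empty; the distance to the empty set is infinite.
\<close>

definition sparse_space :: "'a set \<Rightarrow> ('a \<Rightarrow> 'a \<Rightarrow> real) \<Rightarrow> bool" where
  "sparse_space M d \<longleftrightarrow>
     (\<exists>P :: nat \<Rightarrow> 'a set. (\<Union>n. P n) = M \<and> disjoint_family P \<and> (\<forall>n. finite (P n)) \<and>
        (\<forall>R. \<exists>N. \<forall>n m. n \<noteq> m \<and> n + m \<ge> N \<longrightarrow> (\<forall>x\<in>P n. \<forall>y\<in>P m. d x y \<ge> R)))"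

text \<open>Here \<open>A\<close> and \<open>B\<close> are C*-algebras of operators.\<close>

definition star_homomorphism ::
    "'a operator set \<Rightarrow> 'b operator set \<Rightarrow> ('a operator \<Rightarrow> 'b operator) \<Rightarrow> bool" where
  "star_homomorphism A B \<Phi> \<longleftrightarrow>
     \<Phi> \<in> A \<rightarrow> B \<and>
     (\<forall>a\<in>A. \<forall>b\<in>A. \<Phi> (a + b) = \<Phi> a + \<Phi> b) \<and>
     (\<forall>c. \<forall>a\<in>A. \<Phi> (scaleC_op c a) = scaleC_op c (\<Phi> a)) \<and>
     (\<forall>a\<in>A. \<forall>b\<in>A. \<Phi> (a o\<^sub>L b) = \<Phi> a o\<^sub>L \<Phi> b) \<and>
     (\<forall>a\<in>A. \<Phi> (adj a) = adj (\<Phi> a))"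

definition star_embedding ::
    "'a operator set \<Rightarrow> 'b operator set \<Rightarrow> ('a operator \<Rightarrow> 'b operator) \<Rightarrow> bool" where
  "star_embedding A B \<Phi> \<longleftrightarrow> star_homomorphism A B \<Phi> \<and> inj_on \<Phi> A"

definition rank_preserving :: "'a operator set \<Rightarrow> ('a operator \<Rightarrow> 'b operator) \<Rightarrow> bool" where
  "rank_preserving A \<Phi> \<longleftrightarrow>
     (\<forall>p\<in>A. projection p \<and> rank_one p \<longrightarrow> projection (\<Phi> p) \<and> rank_one (\<Phi> p))"


section \<open>Maps between metric spaces\<close>

definition coarse_map ::
    "'a set \<Rightarrow> ('a \<Rightarrow> 'a \<Rightarrow> real) \<Rightarrow> ('b \<Rightarrow> 'b \<Rightarrow> real) \<Rightarrow> ('a \<Rightarrow> 'b) \<Rightarrow> bool" where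
  "coarse_map X dX dY f \<longleftrightarrow>
     (\<forall>r>0. bdd_above {dY (f x) (f y) | x y. x \<in> X \<and> y \<in> X \<and> dX x y \<le> r})"

definition uniformly_finite_to_one :: "'a set \<Rightarrow> 'b set \<Rightarrow> ('a \<Rightarrow> 'b) \<Rightarrow> bool" where
  "uniformly_finite_to_one X Y f \<longleftrightarrow>
     (\<exists>N. \<forall>y\<in>Y. finite {x \<in> X. f x = y} \<and> card {x \<in> X. f x = y} \<le> N)"


section \<open>Existence of adjoints\<close>

lemma cinner_diff_left: "cinner (f - g) h = cinner f h - cinner g h"
  using cinner_add_left[of "f - g" g h] by simp

lemma cinner_zero_left: "cinner 0 g = 0"
  by (simp add: cinner_def)

lemma cinner_sum_left: "cinner (\<Sum>x\<in>F. f x) g = (\<Sum>x\<in>F. cinner (f x) g)"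
  by (induction F rule: infinite_finite_induct) (auto simp: cinner_add_left cinner_zero_left)

lemma coord_sum: "coord (\<Sum>x\<in>F. f x) y = (\<Sum>x\<in>F. coord (f x) y)"
  by (induction F rule: infinite_finite_induct) auto

lemma truncation_tendsto:
  "((\<lambda>F. \<Sum>x\<in>F. coord f x *\<^sub>C delta x) \<longlongrightarrow> f) (finite_subsets_at_top UNIV)"
proof -
  have eq: "(norm ((\<Sum>x\<in>F. coord f x *\<^sub>C delta x) - f))\<^sup>2
      = (norm f)\<^sup>2 - (\<Sum>x\<in>F. (cmod (coord f x))\<^sup>2)" if F: "finite F" for F
  proof -
    have c: "coord ((\<Sum>x\<in>F. coord f x *\<^sub>C delta x) - f) y
        = (if y \<in> F then 0 else - coord f y)" for y
      using F by (simp add: coord_sum if_distrib[of "\<lambda>t. _ * t"] sum.delta' cong: if_cong)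
    have "(norm ((\<Sum>x\<in>F. coord f x *\<^sub>C delta x) - f))\<^sup>2
        = (\<Sum>\<^sub>\<infinity>y\<in>-F. (cmod (coord f y))\<^sup>2)"
      unfolding norm_ell2_square c by (rule infsum_cong_neutral) auto
    moreover have "(norm f)\<^sup>2 = (\<Sum>\<^sub>\<infinity>y\<in>F \<union> -F. (cmod (coord f y))\<^sup>2)"
      by (simp add: norm_ell2_square)
    ultimately show ?thesis
      using F by (subst (asm) infsum_Un_disjoint) (auto simp: summable_coord_square)
  qed
  have "((\<lambda>F. \<Sum>x\<in>F. (cmod (coord f x))\<^sup>2) \<longlongrightarrow> (norm f)\<^sup>2) (finite_subsets_at_top UNIV)"
    unfolding norm_ell2_square by (rule infsum_tendsto[OF summable_coord_square])
  hence "((\<lambda>F. sqrt ((norm f)\<^sup>2 - (\<Sum>x\<in>F. (cmod (coord f x))\<^sup>2))) \<longlongrightarrow> sqrt ((norm f)\<^sup>2 - (norm f)\<^sup>2))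
      (finite_subsets_at_top UNIV)"
    by (intro tendsto_intros)
  hence "((\<lambda>F. norm ((\<Sum>x\<in>F. coord f x *\<^sub>C delta x) - f)) \<longlongrightarrow> 0) (finite_subsets_at_top UNIV)"
  proof (simp only: diff_self real_sqrt_zero, elim Lim_transform_eventually)
    show "\<forall>\<^sub>F F in finite_subsets_at_top UNIV.
        sqrt ((norm f)\<^sup>2 - (\<Sum>x\<in>F. (cmod (coord f x))\<^sup>2))
        = norm ((\<Sum>x\<in>F. coord f x *\<^sub>C delta x) - f)"
      by (rule eventually_finite_subsets_at_top_weakI) (simp flip: eq)
  qed
  thus ?thesis
    by (rule LIM_zero_cancel[OF tendsto_norm_zero_cancel])
qed

lemma ex_adjoint_vector:
  assumes lin: "\<And>c f. blinfun_apply a (c *\<^sub>C f) = c *\<^sub>C blinfun_apply a f"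
  shows "\<exists>h. \<forall>f. cinner (blinfun_apply a f) g = cinner f h"
proof -
  define k where "k x = cnj (cinner (blinfun_apply a (delta x)) g)" for x
  have fin: "cinner (blinfun_apply a (\<Sum>x\<in>F. c x *\<^sub>C delta x)) g = (\<Sum>x\<in>F. c x * cnj (k x))"
    for F c
    by (simp add: blinfun.sum_right lin cinner_sum_left cinner_scaleC_left k_def)
  have bd: "(\<Sum>x\<in>F. (cmod (k x))\<^sup>2) \<le> (norm a * norm g)\<^sup>2" if F: "finite F" for F
  proof -
    define v where "v = (\<Sum>x\<in>F. k x *\<^sub>C delta x)"
    define s where "s = (\<Sum>x\<in>F. (cmod (k x))\<^sup>2)"
    have "coord v y = (if y \<in> F then k y else 0)" for y
      using F by (simp add: v_def coord_sum if_distrib[of "\<lambda>t. _ * t"] sum.delta' cong: if_cong)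
    hence "(norm v)\<^sup>2 = (\<Sum>\<^sub>\<infinity>x\<in>F. (cmod (k x))\<^sup>2)"
      unfolding norm_ell2_square by (intro infsum_cong_neutral) auto
    hence v: "(norm v)\<^sup>2 = s" using F by (simp add: s_def)
    have "of_real s = cinner (blinfun_apply a v) g"
      unfolding v_def fin s_def by (simp add: complex_norm_square del: of_real_power)
    hence "s = cmod (cinner (blinfun_apply a v) g)"
      by (metis norm_of_real abs_of_nonneg v zero_le_power2)
    also have "\<dots> \<le> norm (blinfun_apply a v) * norm g" by (rule cmod_cinner_le)
    also have "\<dots> \<le> norm a * norm v * norm g" by (intro mult_right_mono norm_blinfun) auto
    finally have "norm v * norm v \<le> norm v * (norm a * norm g)"
      using v by (simp add: power2_eq_square mult_ac)
    hence "norm v \<le> norm a * norm g" by (cases "norm v = 0") auto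
    thus ?thesis using v by (metis s_def norm_ge_zero power_mono)
  qed
  have "(\<lambda>x. (cmod (k x))\<^sup>2) summable_on UNIV"
    by (rule nonneg_bdd_above_summable_on) (auto intro!: bdd_aboveI2 bd)
  then obtain h where h: "coord h = k" by (metis Abs_ell2_inverse mem_Collect_eq)
  have "cinner (blinfun_apply a f) g = cinner f h" for f
  proof (rule tendsto_unique)
    let ?t = "\<lambda>F. \<Sum>x\<in>F. coord f x *\<^sub>C delta x"
    have "bounded_linear (\<lambda>u. cinner u g)"
      by (rule bounded_linear_intro[of _ "norm g"])
        (auto simp: cinner_add_left scaleR_scaleC cinner_scaleC_left scaleR_conv_of_real
          cmod_cinner_le)
    then show "((\<lambda>F. cinner (blinfun_apply a (?t F)) g) \<longlongrightarrow> cinner (blinfun_apply a f) g)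
        (finite_subsets_at_top UNIV)"
      by (intro bounded_linear.tendsto[of "\<lambda>u. cinner u g"] blinfun.tendsto tendsto_const
          truncation_tendsto)
    show "((\<lambda>F. cinner (blinfun_apply a (?t F)) g) \<longlongrightarrow> cinner f h) (finite_subsets_at_top UNIV)"
      unfolding fin cinner_def[of f h] h[symmetric] by (rule infsum_tendsto[OF summable_coord_mult])
  qed simp
  thus ?thesis by blast
qed

lemma cinner_add_right: "cinner f (g + h) = cinner f g + cinner f h"
  unfolding cinner_commute[of f "g + h"] cinner_commute[of f g] cinner_commute[of f h]
  by (simp add: cinner_add_left)

lemma cinner_scaleC_right: "cinner f (c *\<^sub>C g) = cnj c * cinner f g"
  unfolding cinner_commute[of f "c *\<^sub>C g"] cinner_commute[of f g]
  by (simp add: cinner_scaleC_left)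

lemma cinner_eqI:
  assumes "\<And>f. cinner f g = cinner f h"
  shows "g = h"
proof -
  have "cinner f (g - h) = 0" for f
    using cinner_add_right[of f "g - h" h] assms[of f] by simp
  thus ?thesis using cinner_same_eq_0[of "g - h"] by simp
qed

lemma cinner_adj:
  assumes lin: "\<And>c f. blinfun_apply a (c *\<^sub>C f) = c *\<^sub>C blinfun_apply a f"
  shows "cinner (blinfun_apply a f) g = cinner f (blinfun_apply (adj a) g)"
proof -
  obtain b where b: "\<And>f g. cinner (blinfun_apply a f) g = cinner f (b g)"
    using ex_adjoint_vector[OF lin] by metis
  have "bounded_linear b"
  proof (rule bounded_linear_intro[of _ "norm a"])
    fix g h and r :: real
    show "b (g + h) = b g + b h"
      by (rule cinner_eqI) (simp add: cinner_add_right flip: b)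
    show "b (r *\<^sub>R g) = r *\<^sub>R b g"
      by (rule cinner_eqI) (simp add: scaleR_scaleC cinner_scaleC_right flip: b)
    have "norm (b g) * norm (b g) = Re (cinner (b g) (b g))"
      using power2_norm_eq_inner[of "b g"] by (simp add: inner_ell2_def power2_eq_square)
    also have "\<dots> \<le> cmod (cinner (blinfun_apply a (b g)) g)"
      unfolding b by (rule complex_Re_le_cmod)
    also have "\<dots> \<le> norm (blinfun_apply a (b g)) * norm g" by (rule cmod_cinner_le)
    also have "\<dots> \<le> norm a * norm (b g) * norm g"
      by (intro mult_right_mono norm_blinfun) auto
    finally have "norm (b g) * norm (b g) \<le> norm (b g) * (norm g * norm a)"
      by (simp add: mult_ac)
    thus "norm (b g) \<le> norm g * norm a" by (cases "norm (b g) = 0") auto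
  qed
  hence ex: "\<forall>f g. cinner (blinfun_apply a f) g = cinner f (blinfun_apply (Blinfun b) g)"
    by (simp add: b bounded_linear_Blinfun_apply)
  have "\<forall>f g. cinner (blinfun_apply a f) g = cinner f (blinfun_apply (adj a) g)"
    unfolding adj_def
  proof (rule theI[where a = "Blinfun b"], rule ex)
    fix c assume c: "\<forall>f g. cinner (blinfun_apply a f) g = cinner f (blinfun_apply c g)"
    show "c = Blinfun b"
      by (intro blinfun_eqI cinner_eqI) (metis c ex)
  qed
  thus ?thesis by blast
qed

end

theory Submission
  imports Defs
begin

text \<open>
  Write \<open>e p q\<close> for the matrix unit that sends \<open>delta p\<close> to \<open>delta q\<close>, and let \<open>\<Phi>\<close> be the given embedding.
  Rank preservation turns \<open>\<Phi>\<close> into a family of vectors: \<open>\<Phi> (e o o)\<close> is the projection onto the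
  line of a unit vector \<open>v\<close>, and the vectors \<open>\<xi> p = \<Phi> (e o p) v\<close> are orthonormal and implement
  \<open>\<Phi>\<close> on matrix units, since \<open>\<Phi> (e p q)\<close> is the rank one operator taking \<open>\<xi> p\<close> to \<open>\<xi> q\<close>
  (\<open>ex_implementation\<close>). The map \<open>f\<close> sends \<open>p\<close> to a point where \<open>\<xi> p\<close> has a coordinate of modulus
  at least a fixed \<open>\<delta> > 0\<close>.

  Such a \<open>\<delta>\<close> exists because of the hypothesis on ghosts (\<open>coord_lower_bound\<close>). Otherwise some
  vectors \<open>\<xi> (x n)\<close> have coordinates that tend uniformly to \<open>0\<close>; a unit vector with small
  coordinates has little mass on any given finite set, so along a sequence these vectors are almost
  supported on finite blocks of \<open>Y\<close> that recede from each other. The sum of the projections onto the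
  truncated vectors is then an infinite rank ghost projection on a sparse subspace. It lies in the
  uniform Roe algebra because it differs from the image under \<open>\<Phi>\<close> of a diagonal projection by a
  norm convergent series of finite rank operators in that algebra.

  Bessel's inequality bounds the number of points \<open>p\<close> with \<open>f p = y\<close> by \<open>1 / \<delta>\<^sup>2\<close>. If \<open>f\<close> were not
  coarse, there would be points \<open>x n\<close>, \<open>z n\<close> at bounded distance whose images are further and further
  apart. The partial translation \<open>\<Sum>n. e (x n) (z n)\<close> has finite propagation, and a gliding hump
  choice of the points makes the entry of its image at \<open>(f (x n), f (z n))\<close> at least \<open>\<delta>\<^sup>2 / 2\<close>, which
  no operator in the uniform Roe algebra of \<open>Y\<close> allows (\<open>peak_coarse\<close>).

  Both arguments need \<open>\<Phi> (\<Sum>n\<in>I. e (x n) (z n))\<close> to be the sum of the \<open>\<Phi> (e (x n) (z n))\<close>. As \<open>\<Phi>\<close>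
  need not be strongly continuous, this can fail for a given \<open>I\<close>. But the parts of the images that
  escape the sums are pairwise orthogonal as \<open>I\<close> ranges over an almost disjoint family. An
  uncountable such family therefore contains an \<open>I\<close> for which nothing escapes
  (\<open>ex_infinite_strongly_convergent\<close>), since \<open>Y\<close> is countable.
\<close>

section \<open>Square-summable functions: completeness and orthonormal families\<close>

lemma cinner_self: "cinner f f = of_real ((norm f)\<^sup>2)"
  by (simp add: cinner_same norm_ell2_square)

lemma cinner_delta_right: "cinner f (delta x) = coord f x"
proof -
  have "cinner f (delta x) = (\<Sum>\<^sub>\<infinity>y\<in>{x}. coord f y * cnj (coord (delta x) y))"
    unfolding cinner_def by (rule infsum_cong_neutral) auto
  thus ?thesis by simp
qed

lemma cinner_delta_left: "cinner (delta x) f = cnj (coord f x)"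
  by (subst cinner_commute) (simp add: cinner_delta_right)

lemma norm_delta [simp]: "norm (delta x) = 1"
  by (simp add: norm_eq_1 inner_ell2_def cinner_delta_right)

lemma cmod_coord_le: "cmod (coord f x) \<le> norm f"
  using cmod_cinner_le[of f "delta x"] by (simp add: cinner_delta_right)

lemma cinner_zero_right: "cinner f 0 = 0"
  by (subst cinner_commute) (simp add: cinner_zero_left)

lemma cinner_diff_right: "cinner f (g - h) = cinner f g - cinner f h"
  using cinner_add_right[of f "g - h" h] by simp

lemma cinner_sum_right: "cinner f (\<Sum>x\<in>F. g x) = (\<Sum>x\<in>F. cinner f (g x))"
  by (induction F rule: infinite_finite_induct) (auto simp: cinner_add_right cinner_zero_right)

lemma sum_coord_square_le: "finite F \<Longrightarrow> (\<Sum>x\<in>F. (cmod (coord f x))\<^sup>2) \<le> (norm f)\<^sup>2"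
  unfolding norm_ell2_square by (rule finite_sum_le_infsum[OF summable_coord_square]) auto

lemma norm_ell2_leI:
  assumes "0 \<le> e" "\<And>F. finite F \<Longrightarrow> (\<Sum>x\<in>F. (cmod (coord f x))\<^sup>2) \<le> e\<^sup>2"
  shows "norm f \<le> e"
proof -
  have "(norm f)\<^sup>2 \<le> e\<^sup>2"
    unfolding norm_ell2_square
    by (rule infsum_le_finite_sums[OF summable_coord_square]) (auto simp: assms)
  thus ?thesis using assms(1) by (rule power2_le_imp_le)
qed

lemma bounded_linear_coord: "bounded_linear (\<lambda>f. coord f x)"
  by (rule bounded_linear_intro[of _ 1]) (auto simp: cmod_coord_le scaleR_conv_of_real)

lemmas tendsto_coord = bounded_linear.tendsto[OF bounded_linear_coord]

instance ell2 :: (type) banach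
proof
  fix s :: "nat \<Rightarrow> 'a ell2"
  assume s: "Cauchy s"
  have "Cauchy (\<lambda>n. coord (s n) x)" for x
    by (rule bounded_linear.Cauchy[OF bounded_linear_coord s])
  then obtain k where k: "\<And>x. (\<lambda>n. coord (s n) x) \<longlonglongrightarrow> k x"
    unfolding Cauchy_convergent_iff convergent_def by metis
  have bd: "\<exists>N. \<forall>m\<ge>N. \<forall>F. finite F \<longrightarrow> (\<Sum>x\<in>F. (cmod (coord (s m) x - k x))\<^sup>2) \<le> e\<^sup>2"
    if "e > 0" for e
  proof -
    obtain N where N: "\<And>m n. m \<ge> N \<Longrightarrow> n \<ge> N \<Longrightarrow> norm (s m - s n) < e"
      using s \<open>e > 0\<close> unfolding Cauchy_def dist_norm by meson
    have "(\<Sum>x\<in>F. (cmod (coord (s m) x - k x))\<^sup>2) \<le> e\<^sup>2" if "m \<ge> N" "finite F" for m F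
    proof (rule LIMSEQ_le_const2)
      show "(\<lambda>n. \<Sum>x\<in>F. (cmod (coord (s m) x - coord (s n) x))\<^sup>2)
          \<longlonglongrightarrow> (\<Sum>x\<in>F. (cmod (coord (s m) x - k x))\<^sup>2)"
        by (intro tendsto_intros k)
      have "(\<Sum>x\<in>F. (cmod (coord (s m) x - coord (s n) x))\<^sup>2) \<le> e\<^sup>2" if "n \<ge> N" for n
      proof -
        have "(\<Sum>x\<in>F. (cmod (coord (s m - s n) x))\<^sup>2) \<le> (norm (s m - s n))\<^sup>2"
          by (rule sum_coord_square_le[OF \<open>finite F\<close>])
        also have "\<dots> \<le> e\<^sup>2"
          using N[OF \<open>m \<ge> N\<close> that] by (intro power_mono) auto
        finally show ?thesis by simp
      qed
      thus "\<exists>N. \<forall>n\<ge>N. (\<Sum>x\<in>F. (cmod (coord (s m) x - coord (s n) x))\<^sup>2) \<le> e\<^sup>2" by blast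
    qed
    thus ?thesis by blast
  qed
  obtain N where "\<forall>F. finite F \<longrightarrow> (\<Sum>x\<in>F. (cmod (coord (s N) x - k x))\<^sup>2) \<le> 1\<^sup>2"
    using bd[of 1] by auto
  hence "(\<lambda>x. (cmod (coord (s N) x - k x))\<^sup>2) summable_on UNIV"
    by (intro nonneg_bdd_above_summable_on) (auto intro!: bdd_aboveI2)
  then obtain h where h: "\<And>x. coord h x = coord (s N) x - k x"
    using Abs_ell2_inverse[of "\<lambda>x. coord (s N) x - k x"] by (metis (mono_tags) mem_Collect_eq)
  have "s \<longlonglongrightarrow> s N - h"
    unfolding tendsto_iff
  proof (intro allI impI)
    fix e :: real assume "e > 0"
    then obtain M where M: "\<forall>m\<ge>M. \<forall>F. finite F \<longrightarrow>
        (\<Sum>x\<in>F. (cmod (coord (s m) x - k x))\<^sup>2) \<le> (e / 2)\<^sup>2"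
      using bd[of "e / 2"] by auto
    have "norm (s m - (s N - h)) \<le> e / 2" if "m \<ge> M" for m
      using M that \<open>e > 0\<close> by (intro norm_ell2_leI) (auto simp: h)
    hence "dist (s m) (s N - h) < e" if "m \<ge> M" for m
      using that \<open>e > 0\<close> unfolding dist_norm by fastforce
    thus "\<forall>\<^sub>F m in sequentially. dist (s m) (s N - h) < e"
      unfolding eventually_sequentially by blast
  qed
  thus "convergent s" unfolding convergent_def by blast
qed

definition orthonormal_on :: "'i set \<Rightarrow> ('i \<Rightarrow> 'a ell2) \<Rightarrow> bool" where
  "orthonormal_on S e \<longleftrightarrow> (\<forall>i\<in>S. \<forall>j\<in>S. cinner (e i) (e j) = (if i = j then 1 else 0))"

lemma orthonormal_on_norm: "orthonormal_on S e \<Longrightarrow> i \<in> S \<Longrightarrow> norm (e i) = 1"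
  by (simp add: norm_eq_1 inner_ell2_def orthonormal_on_def)

lemma orthonormal_on_norm_sum:
  assumes "orthonormal_on S e" "finite F" "F \<subseteq> S"
  shows "(norm (\<Sum>i\<in>F. c i *\<^sub>C e i))\<^sup>2 = (\<Sum>i\<in>F. (cmod (c i))\<^sup>2)"
proof -
  have "complex_of_real ((norm (\<Sum>i\<in>F. c i *\<^sub>C e i))\<^sup>2)
      = (\<Sum>i\<in>F. \<Sum>j\<in>F. c i * (cnj (c j) * cinner (e i) (e j)))"
    unfolding cinner_self[symmetric] cinner_sum_left
    by (simp add: cinner_sum_right cinner_scaleC_left cinner_scaleC_right sum_distrib_left
        mult.left_commute)
  also have "\<dots> = (\<Sum>i\<in>F. \<Sum>j\<in>F. if i = j then c i * cnj (c j) else 0)"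
    using assms(1,3) by (intro sum.cong) (auto simp: orthonormal_on_def subset_iff)
  also have "\<dots> = of_real (\<Sum>i\<in>F. (cmod (c i))\<^sup>2)"
    using assms(2) by (simp add: complex_norm_square del: of_real_power)
  finally show ?thesis by (simp only: of_real_eq_iff)
qed

lemma Bessel_inequality:
  assumes "orthonormal_on S e" "finite F" "F \<subseteq> S"
  shows "(\<Sum>i\<in>F. (cmod (cinner v (e i)))\<^sup>2) \<le> (norm v)\<^sup>2"
proof -
  define s where "s = (\<Sum>i\<in>F. cinner v (e i) *\<^sub>C e i)"
  have vs: "cinner v s = of_real (\<Sum>i\<in>F. (cmod (cinner v (e i)))\<^sup>2)"
    unfolding s_def
    by (simp add: cinner_sum_right cinner_scaleC_right complex_norm_square mult.commute
        del: of_real_power)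
  have ns: "(norm s)\<^sup>2 = (\<Sum>i\<in>F. (cmod (cinner v (e i)))\<^sup>2)"
    unfolding s_def by (rule orthonormal_on_norm_sum[OF assms])
  have "0 \<le> (norm (v - s))\<^sup>2" by simp
  also have "\<dots> = (norm v)\<^sup>2 - 2 * inner v s + (norm s)\<^sup>2"
    unfolding power2_norm_eq_inner by (simp add: inner_diff_left inner_diff_right inner_commute)
  finally show ?thesis by (simp add: inner_ell2_def vs ns)
qed

text \<open>
  Bessel's inequality is used here only in the form of a count: it yields the finite fibres of the
  peak map, the finite sets to be avoided in inductive choices, and countability statements.
\<close>

lemma Bessel_card:
  assumes "orthonormal_on S e" "\<epsilon> > 0"
  shows "finite {i \<in> S. cmod (cinner v (e i)) \<ge> \<epsilon>}"
    and "card {i \<in> S. cmod (cinner v (e i)) \<ge> \<epsilon>} \<le> nat \<lfloor>(norm v)\<^sup>2 / \<epsilon>\<^sup>2\<rfloor>"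
proof -
  have "finite {i \<in> S. cmod (cinner v (e i)) \<ge> \<epsilon>} \<and>
        card {i \<in> S. cmod (cinner v (e i)) \<ge> \<epsilon>} \<le> nat \<lfloor>(norm v)\<^sup>2 / \<epsilon>\<^sup>2\<rfloor>"
  proof (rule finite_if_finite_subsets_card_bdd)
    fix G assume G: "G \<subseteq> {i \<in> S. cmod (cinner v (e i)) \<ge> \<epsilon>}" "finite G"
    have "card G * \<epsilon>\<^sup>2 = (\<Sum>i\<in>G. \<epsilon>\<^sup>2)" by simp
    also have "\<dots> \<le> (\<Sum>i\<in>G. (cmod (cinner v (e i)))\<^sup>2)"
      using G assms(2) by (intro sum_mono power_mono) auto
    also have "\<dots> \<le> (norm v)\<^sup>2"
      using G by (intro Bessel_inequality[OF assms(1)]) auto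
    finally have "card G \<le> (norm v)\<^sup>2 / \<epsilon>\<^sup>2" using assms(2) by (simp add: field_simps)
    thus "card G \<le> nat \<lfloor>(norm v)\<^sup>2 / \<epsilon>\<^sup>2\<rfloor>" by (simp add: le_nat_floor)
  qed
  thus "finite {i \<in> S. cmod (cinner v (e i)) \<ge> \<epsilon>}"
    and "card {i \<in> S. cmod (cinner v (e i)) \<ge> \<epsilon>} \<le> nat \<lfloor>(norm v)\<^sup>2 / \<epsilon>\<^sup>2\<rfloor>" by auto
qed

lemma orthonormal_on_coord_le:
  assumes "orthonormal_on S e" "\<epsilon> > 0"
  shows "finite {i \<in> S. cmod (coord (e i) y) \<ge> \<epsilon>}"
    and "card {i \<in> S. cmod (coord (e i) y) \<ge> \<epsilon>} \<le> nat \<lfloor>1 / \<epsilon>\<^sup>2\<rfloor>"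
  using Bessel_card[OF assms, of "delta y"] by (simp_all add: cinner_delta_left)

lemma finite_large_coord:
  assumes "\<epsilon> > 0" shows "finite {y. cmod (coord f y) \<ge> \<epsilon>}"
proof -
  have "orthonormal_on UNIV delta" by (auto simp: orthonormal_on_def cinner_delta_right)
  from Bessel_card(1)[OF this assms, of f] show ?thesis by (simp add: cinner_delta_right)
qed

text \<open>
  Normalising the nonzero vectors \<open>h i\<close> gives an orthonormal family, and Bessel's inequality leaves
  only finitely many indices for which the coefficient of \<open>v\<close> is at least \<open>1 / (k + 1)\<close>.
\<close>

lemma countable_not_orthogonal:
  assumes orth: "\<And>i j. i \<in> S \<Longrightarrow> j \<in> S \<Longrightarrow> i \<noteq> j \<Longrightarrow> cinner (h i) (h j) = 0"
  shows "countable {i \<in> S. cinner v (h i) \<noteq> 0}"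
proof -
  define S' where "S' = {i \<in> S. h i \<noteq> 0}"
  define e where "e i = complex_of_real (1 / norm (h i)) *\<^sub>C h i" for i
  have "cinner (e i) (e i) = 1" if "i \<in> S'" for i
    using that unfolding S'_def e_def cinner_scaleC_left cinner_scaleC_right
      cinner_self[of "h i"]
    by (simp add: power2_eq_square)
  hence on: "orthonormal_on S' e"
    using orth by (auto simp: orthonormal_on_def S'_def e_def cinner_scaleC_left cinner_scaleC_right)
  have "countable (\<Union>k. {i \<in> S'. cmod (cinner v (e i)) \<ge> 1 / real (Suc k)})"
    by (rule countable_UN[OF countableI_type countable_finite[OF Bessel_card(1)[OF on]]]) simp
  moreover have "{i \<in> S. cinner v (h i) \<noteq> 0}
      \<subseteq> (\<Union>k. {i \<in> S'. cmod (cinner v (e i)) \<ge> 1 / real (Suc k)})"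
  proof
    fix i assume i: "i \<in> {i \<in> S. cinner v (h i) \<noteq> 0}"
    hence "h i \<noteq> 0" by (auto simp: cinner_zero_right)
    hence "cmod (cinner v (e i)) > 0" using i by (simp add: e_def cinner_scaleC_right)
    then obtain k where "1 / real (Suc k) < cmod (cinner v (e i))"
      using nat_approx_posE by blast
    with i \<open>h i \<noteq> 0\<close>
    show "i \<in> (\<Union>k. {i \<in> S'. cmod (cinner v (e i)) \<ge> 1 / real (Suc k)})"
      by (auto simp: S'_def intro: less_imp_le)
  qed
  ultimately show ?thesis using countable_subset by blast
qed

text \<open>
  The limit is the component of \<open>v\<close> orthogonal to the closed span of the family; the
  expansion converges by Bessel's inequality and completeness.
\<close>

lemma orthogonal_remainder:
  fixes e :: "nat \<Rightarrow> 'a ell2"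
  assumes e: "orthonormal_on UNIV e"
  obtains g where "(\<lambda>N. v - (\<Sum>m<N. cinner v (e m) *\<^sub>C e m)) \<longlonglongrightarrow> g" "\<And>m. cinner g (e m) = 0"
proof -
  define c where "c m = cinner v (e m)" for m
  have sq: "summable (\<lambda>m. (cmod (c m))\<^sup>2)"
    by (rule summableI_nonneg_bounded[where x = "(norm v)\<^sup>2"])
      (auto simp: c_def intro!: Bessel_inequality[OF e])
  have "summable (\<lambda>m. c m *\<^sub>C e m)"
    unfolding summable_Cauchy
  proof (intro allI impI)
    fix \<epsilon> :: real assume "\<epsilon> > 0"
    then obtain N where N: "\<And>m n. m \<ge> N \<Longrightarrow> norm (\<Sum>k\<in>{m..<n}. (cmod (c k))\<^sup>2) < \<epsilon>\<^sup>2"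
      using sq unfolding summable_Cauchy by (meson zero_less_power)
    have "norm (\<Sum>k\<in>{m..<n}. c k *\<^sub>C e k) < \<epsilon>" if "m \<ge> N" for m n
    proof (rule power2_less_imp_less)
      show "(norm (\<Sum>k\<in>{m..<n}. c k *\<^sub>C e k))\<^sup>2 < \<epsilon>\<^sup>2"
        using N[OF that, of n]
        by (simp add: orthonormal_on_norm_sum[OF e] abs_of_nonneg sum_nonneg)
    qed (use \<open>\<epsilon> > 0\<close> in simp)
    thus "\<exists>N. \<forall>m\<ge>N. \<forall>n. norm (\<Sum>k\<in>{m..<n}. c k *\<^sub>C e k) < \<epsilon>" by blast
  qed
  hence lim: "(\<lambda>N. v - (\<Sum>m<N. c m *\<^sub>C e m)) \<longlonglongrightarrow> v - (\<Sum>m. c m *\<^sub>C e m)"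
    by (intro tendsto_diff tendsto_const summable_LIMSEQ)
  have "cinner (v - (\<Sum>m. c m *\<^sub>C e m)) (e k) = 0" for k
  proof (rule tendsto_unique)
    have "bounded_linear (\<lambda>u. cinner u (e k))"
      by (rule bounded_linear_intro[of _ "norm (e k)"])
        (auto simp: cinner_add_left scaleR_scaleC cinner_scaleC_left scaleR_conv_of_real
          cmod_cinner_le)
    from bounded_linear.tendsto[OF this lim]
    show "(\<lambda>N. cinner (v - (\<Sum>m<N. c m *\<^sub>C e m)) (e k)) \<longlonglongrightarrow>
        cinner (v - (\<Sum>m. c m *\<^sub>C e m)) (e k)" .
    have "cinner (v - (\<Sum>m<N. c m *\<^sub>C e m)) (e k) = 0" if "N > k" for N
    proof -
      have "cinner (\<Sum>m<N. c m *\<^sub>C e m) (e k) = (\<Sum>m<N. if m = k then c m else 0)"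
        using e unfolding cinner_sum_left cinner_scaleC_left orthonormal_on_def
        by (intro sum.cong) auto
      also have "\<dots> = c k" using that by simp
      finally show ?thesis by (simp add: cinner_diff_left c_def)
    qed
    thus "(\<lambda>N. cinner (v - (\<Sum>m<N. c m *\<^sub>C e m)) (e k)) \<longlonglongrightarrow> 0"
      by (intro tendsto_eventually eventually_sequentiallyI[of "Suc k"]) auto
  qed simp
  thus ?thesis using that lim unfolding c_def by blast
qed

section \<open>Truncation, matrix entries and rank one operators\<close>

lift_definition truncate :: "'a set \<Rightarrow> 'a ell2 \<Rightarrow> 'a ell2" is "\<lambda>S f x. if x \<in> S then f x else 0"
proof -
  fix S :: "'a set" and f :: "'a \<Rightarrow> complex"
  assume f: "(\<lambda>x. (cmod (f x))\<^sup>2) summable_on UNIV"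
  show "(\<lambda>x. (cmod (if x \<in> S then f x else 0))\<^sup>2) summable_on UNIV"
    by (rule summable_on_comparison_test[OF f]) auto
qed

lemma coord_truncate [simp]: "coord (truncate S f) x = (if x \<in> S then coord f x else 0)"
  by transfer simp

lemma norm_mono_coord:
  assumes "\<And>x. cmod (coord f x) \<le> cmod (coord g x)"
  shows "norm f \<le> norm g"
proof (rule norm_ell2_leI)
  fix F :: "'a set" assume F: "finite F"
  have "(\<Sum>x\<in>F. (cmod (coord f x))\<^sup>2) \<le> (\<Sum>x\<in>F. (cmod (coord g x))\<^sup>2)"
    by (intro sum_mono power_mono assms) auto
  also have "\<dots> \<le> (norm g)\<^sup>2" by (rule sum_coord_square_le[OF F])
  finally show "(\<Sum>x\<in>F. (cmod (coord f x))\<^sup>2) \<le> (norm g)\<^sup>2" .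
qed simp

lemma norm_truncate_le: "norm (truncate S f) \<le> norm f"
  by (rule norm_mono_coord) auto

lemma bounded_linear_truncate: "bounded_linear (truncate S)"
  by (rule bounded_linear_intro[of _ 1]) (auto intro!: ell2_eqI norm_truncate_le)

lemma truncate_finite:
  assumes "finite F" shows "truncate F f = (\<Sum>x\<in>F. coord f x *\<^sub>C delta x)"
  using assms
  by (intro ell2_eqI) (simp add: coord_sum if_distrib[of "\<lambda>t. _ * t"] sum.delta' cong: if_cong)

lemma norm_truncate_finite:
  assumes "finite F" shows "(norm (truncate F f))\<^sup>2 = (\<Sum>x\<in>F. (cmod (coord f x))\<^sup>2)"
proof -
  have "(norm (truncate F f))\<^sup>2 = (\<Sum>\<^sub>\<infinity>x\<in>F. (cmod (coord f x))\<^sup>2)"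
    unfolding norm_ell2_square by (rule infsum_cong_neutral) auto
  thus ?thesis using assms by simp
qed

lemma ex_finite_truncate:
  assumes "e > 0"
  obtains F where "finite F" "norm (f - truncate F f) < e"
proof -
  have "\<forall>\<^sub>F F in finite_subsets_at_top UNIV. dist (\<Sum>x\<in>F. coord f x *\<^sub>C delta x) f < e"
    using truncation_tendsto[of f] assms by (simp add: tendsto_iff)
  then obtain F where F: "finite F" "dist (\<Sum>x\<in>F. coord f x *\<^sub>C delta x) f < e"
    unfolding eventually_finite_subsets_at_top by blast
  thus ?thesis using that[of F] by (simp add: truncate_finite dist_norm norm_minus_commute)
qed

definition clinear_operator :: "'a operator \<Rightarrow> bool" where
  "clinear_operator a \<longleftrightarrow> (\<forall>c f. blinfun_apply a (c *\<^sub>C f) = c *\<^sub>C blinfun_apply a f)"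

lemma matrix_entry_coord: "matrix_entry a x y = coord (blinfun_apply a (delta x)) y"
  by (simp add: matrix_entry_def cinner_delta_right)

text \<open>
  The finite combinations of the vectors \<open>delta x\<close> are dense, so an operator is determined by its
  matrix.
\<close>

lemma clinear_operator_eqI:
  assumes a: "clinear_operator a" and b: "clinear_operator b"
    and eq: "\<And>x y. matrix_entry a x y = matrix_entry b x y"
  shows "a = b"
proof (rule blinfun_eqI)
  fix f
  have d: "blinfun_apply a (delta x) = blinfun_apply b (delta x)" for x
    using eq by (intro ell2_eqI) (simp add: matrix_entry_coord)
  have "((\<lambda>F. blinfun_apply a (\<Sum>x\<in>F. coord f x *\<^sub>C delta x)) \<longlongrightarrow> blinfun_apply a f)
      (finite_subsets_at_top UNIV)"
    "((\<lambda>F. blinfun_apply b (\<Sum>x\<in>F. coord f x *\<^sub>C delta x)) \<longlongrightarrow> blinfun_apply b f)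
      (finite_subsets_at_top UNIV)"
    by (intro blinfun.tendsto tendsto_const truncation_tendsto)+
  moreover have "blinfun_apply a (\<Sum>x\<in>F. coord f x *\<^sub>C delta x)
      = blinfun_apply b (\<Sum>x\<in>F. coord f x *\<^sub>C delta x)" for F
    using a b d by (simp add: clinear_operator_def blinfun.sum_right)
  ultimately show "blinfun_apply a f = blinfun_apply b f"
    by (intro tendsto_unique[of "finite_subsets_at_top UNIV"]) auto
qed

lemma adj_eqI:
  assumes a: "clinear_operator a" and b: "clinear_operator b"
    and eq: "\<And>x y. matrix_entry b x y = cnj (matrix_entry a y x)"
  shows "adj a = b"
proof (rule clinear_operator_eqI[OF _ b])
  have adj: "cinner (blinfun_apply a f) g = cinner f (blinfun_apply (adj a) g)" for f g
    using a by (intro cinner_adj) (simp add: clinear_operator_def)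
  show "clinear_operator (adj a)"
    unfolding clinear_operator_def
    by (intro allI cinner_eqI) (simp add: cinner_scaleC_right flip: adj)
  show "matrix_entry (adj a) x y = matrix_entry b x y" for x y
    using adj[of "delta y" "delta x", THEN arg_cong[of _ _ cnj]] eq[of x y]
    by (simp add: matrix_entry_coord cinner_delta_left cinner_delta_right)
qed

lemma bounded_linear_matrix_entry: "bounded_linear (\<lambda>a. matrix_entry a x y)"
  unfolding matrix_entry_coord
  by (rule bounded_linear_compose[OF bounded_linear_coord blinfun.bounded_linear_left])

text \<open>
  The rank one operator usually written \<open>v \<otimes> u\<^sup>*\<close>. In particular \<open>outer (delta p) (delta q)\<close> is the
  matrix unit sending \<open>delta p\<close> to \<open>delta q\<close>.
\<close>

definition outer :: "'a ell2 \<Rightarrow> 'a ell2 \<Rightarrow> 'a operator" where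
  "outer u v = Blinfun (\<lambda>f. cinner f u *\<^sub>C v)"

lemma bounded_linear_outer: "bounded_linear (\<lambda>f. cinner f u *\<^sub>C v)"
proof (rule bounded_linear_intro[of _ "norm u * norm v"])
  fix f g :: "'a ell2" and r :: real
  show "cinner (f + g) u *\<^sub>C v = cinner f u *\<^sub>C v + cinner g u *\<^sub>C v"
    by (intro ell2_eqI) (simp add: cinner_add_left distrib_right)
  show "cinner (r *\<^sub>R f) u *\<^sub>C v = r *\<^sub>R (cinner f u *\<^sub>C v)"
    by (intro ell2_eqI) (simp add: scaleR_scaleC cinner_scaleC_left)
  show "norm (cinner f u *\<^sub>C v) \<le> norm f * (norm u * norm v)"
    using mult_right_mono[OF cmod_cinner_le[of f u], of "norm v"] by (simp add: norm_scaleC mult.assoc)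
qed

lemma outer_apply [simp]: "blinfun_apply (outer u v) f = cinner f u *\<^sub>C v"
  unfolding outer_def by (simp add: bounded_linear_Blinfun_apply bounded_linear_outer)

lemma outer_zero_right: "outer u 0 = 0"
  by (intro blinfun_eqI ell2_eqI) simp

lemma matrix_entry_outer: "matrix_entry (outer u v) x y = cnj (coord u x) * coord v y"
  by (simp add: matrix_entry_coord cinner_delta_left)

lemma norm_outer_diff_le:
  assumes "norm u = 1" "norm v = 1"
  shows "norm (outer u u - outer v v) \<le> 2 * norm (u - v)"
proof (rule norm_blinfun_bound)
  fix f
  have "blinfun_apply (outer u u - outer v v) f = cinner f u *\<^sub>C (u - v) + cinner f (u - v) *\<^sub>C v"
    by (intro ell2_eqI) (simp add: blinfun.diff_left cinner_diff_right algebra_simps)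
  also have "norm \<dots> \<le> cmod (cinner f u) * norm (u - v) + cmod (cinner f (u - v)) * norm v"
    by (rule order_trans[OF norm_triangle_ineq]) (simp add: norm_scaleC)
  also have "\<dots> \<le> (norm f * norm u) * norm (u - v) + (norm f * norm (u - v)) * norm v"
    by (intro add_mono mult_right_mono cmod_cinner_le) auto
  finally show "norm (blinfun_apply (outer u u - outer v v) f) \<le> 2 * norm (u - v) * norm f"
    using assms by (simp add: algebra_simps)
qed simp

lemma clinear_operator_outer: "clinear_operator (outer u v)"
  unfolding clinear_operator_def
  by (auto intro!: ell2_eqI simp: cinner_scaleC_left)

lemma clinear_operator_diff:
  "clinear_operator a \<Longrightarrow> clinear_operator b \<Longrightarrow> clinear_operator (a - b)"
  unfolding clinear_operator_def
  by (intro allI ell2_eqI) (simp add: blinfun.diff_left right_diff_distrib)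

lemma clinear_operator_compose:
  "clinear_operator a \<Longrightarrow> clinear_operator b \<Longrightarrow> clinear_operator (a o\<^sub>L b)"
  unfolding clinear_operator_def by simp

lemma compose_outer:
  "clinear_operator a \<Longrightarrow> a o\<^sub>L outer u v = outer u (blinfun_apply a v)"
  by (intro blinfun_eqI) (simp add: clinear_operator_def)

lemma outer_compose:
  "clinear_operator a \<Longrightarrow> outer u v o\<^sub>L a = outer (blinfun_apply (adj a) u) v"
  by (intro blinfun_eqI) (simp add: clinear_operator_def cinner_adj)

text \<open>
  A projection fixes its range, so self-adjointness forces the coefficient of \<open>p f\<close> along a unit
  vector \<open>v\<close> in the range to be \<open>cinner f v\<close>.
\<close>

lemma rank_one_projection:
  assumes p: "projection p" "rank_one p" and lin: "clinear_operator p"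
  obtains v where "norm v = 1" "p = outer v v"
proof -
  obtain w where w: "w \<noteq> 0" "range (blinfun_apply p) = range (\<lambda>c. c *\<^sub>C w)"
    using p(2) unfolding rank_one_def by blast
  define v where "v = complex_of_real (1 / norm w) *\<^sub>C w"
  have v1: "norm v = 1" using w(1) by (simp add: v_def norm_scaleC norm_divide)
  have "w = 1 *\<^sub>C w" by (rule ell2_eqI) simp
  hence "w \<in> range (blinfun_apply p)" unfolding w(2) by (rule range_eqI)
  then obtain g where g: "w = blinfun_apply p g" by blast
  have "blinfun_apply p w = w"
    using p(1) unfolding projection_def g by (metis blinfun_apply_blinfun_compose)
  hence pv: "blinfun_apply p v = v" using lin by (simp add: v_def clinear_operator_def)
  have "blinfun_apply p f = cinner f v *\<^sub>C v" for f
  proof -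
    have "blinfun_apply p f \<in> range (\<lambda>c. c *\<^sub>C w)" unfolding w(2)[symmetric] by simp
    then obtain c where c: "blinfun_apply p f = c *\<^sub>C w" by blast
    have wv: "w = complex_of_real (norm w) *\<^sub>C v"
      using w(1) by (intro ell2_eqI) (simp add: v_def)
    have "cinner (blinfun_apply p f) v = cinner f (blinfun_apply (adj p) v)"
      using lin by (intro cinner_adj) (simp add: clinear_operator_def)
    also have "\<dots> = cinner f v" using p(1) pv by (simp add: projection_def)
    finally have "cinner f v = c * complex_of_real (norm w)"
      using cinner_self[of v] v1 unfolding c by (subst (asm) wv) (simp add: cinner_scaleC_left)
    thus ?thesis unfolding c by (subst wv) (intro ell2_eqI, simp)
  qed
  hence "p = outer v v" by (intro blinfun_eqI) simp
  thus ?thesis using that v1 by blast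
qed

lemma matrix_unit_projection: "projection (outer (delta p) (delta p))" "rank_one (outer (delta p) (delta p))"
proof -
  show "projection (outer (delta p) (delta p))"
    unfolding projection_def
  proof
    show "outer (delta p) (delta p) o\<^sub>L outer (delta p) (delta p) = outer (delta p) (delta p)"
      by (intro blinfun_eqI ell2_eqI) (simp add: cinner_delta_right)
    show "adj (outer (delta p) (delta p)) = outer (delta p) (delta p)"
      by (intro adj_eqI clinear_operator_outer) (auto simp: matrix_entry_outer)
  qed
  have "c *\<^sub>C delta p = blinfun_apply (outer (delta p) (delta p)) (c *\<^sub>C delta p)" for c
    by (simp add: cinner_delta_right)
  hence "range (blinfun_apply (outer (delta p) (delta p))) = range (\<lambda>c. c *\<^sub>C delta p)"
    by (auto simp: image_iff) 
  moreover have "delta p \<noteq> 0" using norm_delta[of p] by (metis norm_zero zero_neq_one)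
  ultimately show "rank_one (outer (delta p) (delta p))" unfolding rank_one_def by blast
qed

section \<open>Uniform Roe algebras\<close>

lemma bounded_operators_clinear: "a \<in> bounded_operators M \<Longrightarrow> clinear_operator a"
  by (simp add: bounded_operators_def clinear_operator_def)

lemma outer_in_bounded_operators:
  assumes "\<And>x. x \<notin> M \<Longrightarrow> coord u x = 0" "\<And>x. x \<notin> M \<Longrightarrow> coord v x = 0"
  shows "outer u v \<in> bounded_operators M"
proof -
  have "cinner f u = 0" if "\<forall>x\<in>M. coord f x = 0" for f
    unfolding cinner_def using that assms(1)
    by (intro infsum_0) (metis complex_cnj_zero mult_zero_left mult_zero_right)
  thus ?thesis
    using clinear_operator_outer[of u v] assms
    by (auto simp: bounded_operators_def clinear_operator_def intro!: ell2_eqI)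
qed

lemma closed_bounded_operators: "closed (bounded_operators M)"
proof -
  have ap: "continuous_on UNIV (\<lambda>a. blinfun_apply a f)" for f :: "'a ell2"
    by (intro continuous_intros)
  have "closed {a :: 'a operator. blinfun_apply a (c *\<^sub>C f) = c *\<^sub>C blinfun_apply a f}" for c f
    by (rule closed_Collect_eq[OF ap bounded_linear.continuous_on[OF bounded_linear_scaleC ap]])
  moreover have "closed {a :: 'a operator. coord (blinfun_apply a f) x = 0}" for f x
    by (rule closed_Collect_eq[OF bounded_linear.continuous_on[OF bounded_linear_coord ap]
          continuous_on_const])
  moreover have "closed {a :: 'a operator. blinfun_apply a f = 0}" for f
    by (rule closed_Collect_eq[OF ap continuous_on_const])
  moreover have "bounded_operators M
      = (\<Inter>c. \<Inter>f. {a. blinfun_apply a (c *\<^sub>C f) = c *\<^sub>C blinfun_apply a f})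
        \<inter> (\<Inter>f. \<Inter>x\<in>-M. {a. coord (blinfun_apply a f) x = 0})
        \<inter> (\<Inter>f\<in>{f. \<forall>x\<in>M. coord f x = 0}. {a. blinfun_apply a f = 0})"
    unfolding bounded_operators_def by blast
  ultimately show ?thesis by (auto intro!: closed_INT closed_Int)
qed

lemma uniform_Roe_algebra_bounded: "uniform_Roe_algebra M d \<subseteq> bounded_operators M"
  unfolding uniform_Roe_algebra_def
  by (rule closure_minimal[OF _ closed_bounded_operators]) auto

lemma uniform_Roe_algebra_clinear: "a \<in> uniform_Roe_algebra M d \<Longrightarrow> clinear_operator a"
  using uniform_Roe_algebra_bounded bounded_operators_clinear by blast

lemma uniform_Roe_algebra_coord:
  "a \<in> uniform_Roe_algebra M d \<Longrightarrow> x \<notin> M \<Longrightarrow> coord (blinfun_apply a f) x = 0"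
  using uniform_Roe_algebra_bounded[of M d] by (auto simp: bounded_operators_def)

lemma uniform_Roe_algebra_delta:
  assumes "a \<in> uniform_Roe_algebra M d" "x \<notin> M"
  shows "blinfun_apply a (delta x) = 0"
proof -
  have "a \<in> bounded_operators M" using assms(1) uniform_Roe_algebra_bounded by blast
  moreover have "\<forall>z\<in>M. coord (delta x) z = 0" using assms(2) by auto
  ultimately show ?thesis unfolding bounded_operators_def by blast
qed

lemma uniform_Roe_algebraI:
  "a \<in> bounded_operators M \<Longrightarrow> finite_propagation M d a \<Longrightarrow> a \<in> uniform_Roe_algebra M d"
  unfolding uniform_Roe_algebra_def by (rule subsetD[OF closure_subset]) simp

lemma bounded_operators_diff:
  "a \<in> bounded_operators M \<Longrightarrow> b \<in> bounded_operators M \<Longrightarrow> a - b \<in> bounded_operators M"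
  using clinear_operator_diff[of a b]
  by (simp add: bounded_operators_def clinear_operator_def blinfun.diff_left)

lemma uniform_Roe_algebra_diff:
  assumes "a \<in> uniform_Roe_algebra M d" "b \<in> uniform_Roe_algebra M d"
  shows "a - b \<in> uniform_Roe_algebra M d"
proof -
  let ?S = "{a \<in> bounded_operators M. finite_propagation M d a}"
  obtain s t where s: "\<And>n. s n \<in> ?S" "s \<longlonglongrightarrow> a" and t: "\<And>n. t n \<in> ?S" "t \<longlonglongrightarrow> b"
    using assms unfolding uniform_Roe_algebra_def closure_sequential by blast
  have "s n - t n \<in> ?S" for n
  proof -
    obtain r r' where "r > 0" "\<forall>x\<in>M. \<forall>y\<in>M. d x y > r \<longrightarrow> matrix_entry (s n) x y = 0"
      "\<forall>x\<in>M. \<forall>y\<in>M. d x y > r' \<longrightarrow> matrix_entry (t n) x y = 0"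
      using s(1)[of n] t(1)[of n] unfolding finite_propagation_def by blast
    hence "finite_propagation M d (s n - t n)"
      unfolding finite_propagation_def
      by (intro exI[of _ "max r r'"]) (auto simp: matrix_entry_coord blinfun.diff_left)
    thus ?thesis using s(1)[of n] t(1)[of n] by (auto intro: bounded_operators_diff)
  qed
  thus ?thesis
    unfolding uniform_Roe_algebra_def closure_sequential
    by (intro exI[of _ "\<lambda>n. s n - t n"] conjI allI tendsto_diff s(2) t(2))
qed

lemma zero_in_uniform_Roe_algebra: "0 \<in> uniform_Roe_algebra X d"
  by (rule uniform_Roe_algebraI)
    (auto simp: bounded_operators_def finite_propagation_def matrix_entry_coord
      intro!: ell2_eqI exI[of _ 1])

lemma uniform_Roe_algebra_add:
  assumes "a \<in> uniform_Roe_algebra M d" "b \<in> uniform_Roe_algebra M d"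
  shows "a + b \<in> uniform_Roe_algebra M d"
  using uniform_Roe_algebra_diff[OF assms(1)
      uniform_Roe_algebra_diff[OF zero_in_uniform_Roe_algebra assms(2)]] by simp

lemma uniform_Roe_algebra_suminf:
  assumes "\<And>n. D n \<in> uniform_Roe_algebra M d" "summable D"
  shows "suminf D \<in> uniform_Roe_algebra M d"
proof (rule closed_sequentially[OF _ _ summable_LIMSEQ[OF assms(2)]])
  show "closed (uniform_Roe_algebra M d)" by (simp add: uniform_Roe_algebra_def)
  show "sum D {..<N} \<in> uniform_Roe_algebra M d" for N
    by (induction N) (simp_all add: assms(1) uniform_Roe_algebra_add zero_in_uniform_Roe_algebra)
qed

text \<open>
  What remains of finite propagation in the norm closure: a matrix entry of \<open>a\<close> differs from that
  of an approximant by at most the norm of the difference.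
\<close>

lemma uniform_Roe_algebra_approx:
  assumes "a \<in> uniform_Roe_algebra M d" "e > 0"
  obtains r where "r > 0" "\<And>x y. x \<in> M \<Longrightarrow> y \<in> M \<Longrightarrow> d x y > r \<Longrightarrow> cmod (matrix_entry a x y) < e"
proof -
  obtain b where b: "b \<in> bounded_operators M" "finite_propagation M d b" "dist b a < e"
    using assms unfolding uniform_Roe_algebra_def closure_approachable by blast
  then obtain r where r: "r > 0" "\<forall>x\<in>M. \<forall>y\<in>M. d x y > r \<longrightarrow> matrix_entry b x y = 0"
    unfolding finite_propagation_def by blast
  have "cmod (matrix_entry a x y) < e" if "x \<in> M" "y \<in> M" "d x y > r" for x y
  proof -
    have "matrix_entry a x y = coord (blinfun_apply (a - b) (delta x)) y"
      using r that by (simp add: matrix_entry_coord blinfun.diff_left)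
    also have "cmod \<dots> \<le> norm (blinfun_apply (a - b) (delta x))" by (rule cmod_coord_le)
    also have "\<dots> \<le> norm (a - b)" using norm_blinfun[of "a - b" "delta x"] by simp
    also have "\<dots> < e" using b(3) by (simp add: dist_norm norm_minus_commute)
    finally show ?thesis .
  qed
  thus ?thesis using that r(1) by blast
qed

definition truncate_op :: "'a set \<Rightarrow> 'a operator" where
  "truncate_op S = Blinfun (truncate S)"

lemma truncate_op_apply [simp]: "blinfun_apply (truncate_op S) = truncate S"
  unfolding truncate_op_def by (simp add: bounded_linear_Blinfun_apply bounded_linear_truncate)

text \<open>
  Compression to \<open>S\<close> is continuous and does not create new matrix entries, so it maps approximants
  to approximants. This brings operators of the large algebra that live on a subspace into the
  uniform Roe algebra of that subspace.
\<close>

lemma corner_in_uniform_Roe_algebra: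
  assumes a: "a \<in> uniform_Roe_algebra M d" and "S \<subseteq> M"
  shows "truncate_op S o\<^sub>L a o\<^sub>L truncate_op S \<in> uniform_Roe_algebra S d"
proof -
  let ?S = "\<lambda>M. {a \<in> bounded_operators M. finite_propagation M d a}"
  let ?c = "\<lambda>b. truncate_op S o\<^sub>L b o\<^sub>L truncate_op S"
  obtain s where s: "\<And>n. s n \<in> ?S M" "s \<longlonglongrightarrow> a"
    using a unfolding uniform_Roe_algebra_def closure_sequential by blast
  have "?c b \<in> ?S S" if b: "b \<in> ?S M" for b
  proof -
    have cl: "truncate S (c *\<^sub>C f) = c *\<^sub>C truncate S f" for c f
      by (intro ell2_eqI) simp
    have z: "truncate S f = 0" if "\<forall>x\<in>S. coord f x = 0" for f
      using that by (intro ell2_eqI) simp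
    have "?c b \<in> bounded_operators S"
      using b by (simp add: bounded_operators_def cl z)
    moreover have "matrix_entry (?c b) x y = matrix_entry b x y" if "x \<in> S" "y \<in> S" for x y
    proof -
      have "truncate S (delta x) = delta x" using that by (intro ell2_eqI) auto
      thus ?thesis using that by (simp add: matrix_entry_coord)
    qed
    ultimately show ?thesis
      using b \<open>S \<subseteq> M\<close> unfolding finite_propagation_def by (auto simp: subset_iff)
  qed
  moreover have "(\<lambda>n. ?c (s n)) \<longlonglongrightarrow> ?c a"
    by (intro bounded_bilinear.tendsto[OF bounded_bilinear_blinfun_compose] tendsto_const s(2))
  ultimately show ?thesis
    unfolding uniform_Roe_algebra_def closure_sequential using s(1)
    by (intro exI[of _ "\<lambda>n. ?c (s n)"] conjI allI) simp_all
qed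

lemma finite_support_in_uniform_Roe_algebra:
  assumes "finite F" "F \<subseteq> M" "\<And>x. x \<notin> F \<Longrightarrow> coord u x = 0" "\<And>x. x \<notin> F \<Longrightarrow> coord v x = 0"
  shows "outer u v \<in> uniform_Roe_algebra M d"
proof (rule uniform_Roe_algebraI)
  show "outer u v \<in> bounded_operators M"
    using assms by (intro outer_in_bounded_operators) auto
  have "bdd_above ((\<lambda>(x, y). d x y) ` (F \<times> F))"
    using assms(1) by (intro bdd_above_finite) auto
  then obtain r where r: "\<And>x y. x \<in> F \<Longrightarrow> y \<in> F \<Longrightarrow> d x y \<le> r"
    unfolding bdd_above_def by fastforce
  show "finite_propagation M d (outer u v)"
    unfolding finite_propagation_def
  proof (intro exI[of _ "max r 1"] conjI ballI impI)
    fix x y assume "max r 1 < d x y"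
    hence "x \<notin> F \<or> y \<notin> F" using r[of x y] by auto
    thus "matrix_entry (outer u v) x y = 0" using assms(3,4) by (auto simp: matrix_entry_outer)
  qed simp
qed

lemma matrix_unit_in_uniform_Roe_algebra:
  assumes "p \<in> X" "q \<in> X"
  shows "outer (delta p) (delta q) \<in> uniform_Roe_algebra X d"
  using assms by (intro finite_support_in_uniform_Roe_algebra[of "{p, q}"]) auto

lemma finite_neighbourhood:
  assumes "Metric_space M d" "uniformly_locally_finite M d" "finite V"
  shows "finite {q \<in> M. \<exists>p\<in>V \<inter> M. d p q \<le> r}"
proof (rule finite_subset)
  show "{q \<in> M. \<exists>p\<in>V \<inter> M. d p q \<le> r}
      \<subseteq> (\<Union>p\<in>V \<inter> M. Metric_space.mcball M d p (max r 1))"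
    by (auto simp: Metric_space.in_mcball[OF assms(1)])
  have "finite (Metric_space.mcball M d p (max r 1))" if "p \<in> M" for p
  proof -
    have "max r 1 > 0" by simp
    thus ?thesis using assms(2) that unfolding uniformly_locally_finite_def by blast
  qed
  thus "finite (\<Union>p\<in>V \<inter> M. Metric_space.mcball M d p (max r 1))"
    using assms(3) by auto
qed

lemma uniformly_locally_finite_countable:
  assumes "Metric_space M d" "uniformly_locally_finite M d"
  shows "countable M"
proof (cases "M = {}")
  case False
  then obtain p where p: "p \<in> M" by blast
  have "M \<subseteq> (\<Union>n. {q \<in> M. \<exists>p\<in>{p} \<inter> M. d p q \<le> real n})"
    using p real_arch_simple by auto
  moreover have "countable (\<Union>n. {q \<in> M. \<exists>p\<in>{p} \<inter> M. d p q \<le> real n})"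
    by (rule countable_UN[OF countableI_type countable_finite[OF finite_neighbourhood[OF assms]]])
      simp
  ultimately show ?thesis by (rule countable_subset)
qed simp

section \<open>Partial translations\<close>

text \<open>
  The partial translation \<open>delta (x i) \<mapsto> delta (z i)\<close> for \<open>i \<in> I\<close>, which is zero on the other basis
  vectors. The formula defines a bounded operator when \<open>x\<close> and \<open>z\<close> are injective; inverting \<open>z\<close>
  on all indices, not just on \<open>I\<close>, makes the formulas for different \<open>I\<close> agree.
\<close>

definition shift_op :: "('i \<Rightarrow> 'a) \<Rightarrow> ('i \<Rightarrow> 'a) \<Rightarrow> 'i set \<Rightarrow> 'a operator" where
  "shift_op x z I =
    Blinfun (\<lambda>f. Abs_ell2 (\<lambda>w. if w \<in> z ` I then coord f (x (inv z w)) else 0))"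

text \<open>
  Reindexing twice identifies the image of \<open>f\<close> with the restriction of \<open>f\<close> to the points
  \<open>x i\<close> with \<open>i \<in> I\<close>; the operator is a partial isometry.
\<close>

lemma shift_op_square_sum:
  fixes f :: "'a ell2"
  assumes x: "inj x" and z: "inj z"
  shows "((\<lambda>w. (cmod (if w \<in> z ` I then coord f (x (inv z w)) else 0))\<^sup>2) has_sum
    (norm (truncate (x ` I) f))\<^sup>2) UNIV"
proof -
  have "((\<lambda>w. (cmod (coord (truncate (x ` I) f) w))\<^sup>2) has_sum (norm (truncate (x ` I) f))\<^sup>2) UNIV"
    unfolding norm_ell2_square by (rule has_sum_infsum[OF summable_coord_square])
  also have "?this \<longleftrightarrow> ((\<lambda>w. (cmod (coord f w))\<^sup>2) has_sum (norm (truncate (x ` I) f))\<^sup>2) (x ` I)"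
    by (rule has_sum_cong_neutral) auto
  also have "\<dots> \<longleftrightarrow> ((\<lambda>i. (cmod (coord f (x i)))\<^sup>2) has_sum (norm (truncate (x ` I) f))\<^sup>2) I"
    by (subst has_sum_reindex) (auto intro: inj_on_subset[OF x] simp: o_def)
  also have "\<dots> \<longleftrightarrow> ((\<lambda>w. (cmod (coord f (x (inv z w))))\<^sup>2) has_sum
      (norm (truncate (x ` I) f))\<^sup>2) (z ` I)"
    by (subst has_sum_reindex) (auto intro: inj_on_subset[OF z] simp: o_def z)
  also have "\<dots> \<longleftrightarrow> ((\<lambda>w. (cmod (if w \<in> z ` I then coord f (x (inv z w)) else 0))\<^sup>2) has_sum
      (norm (truncate (x ` I) f))\<^sup>2) UNIV"
    by (rule has_sum_cong_neutral) auto
  finally show ?thesis .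
qed

lemma coord_shift_op:
  assumes x: "inj x" and z: "inj z"
  shows "coord (blinfun_apply (shift_op x z I) f) w
    = (if w \<in> z ` I then coord f (x (inv z w)) else 0)"
proof -
  define S where "S f = Abs_ell2 (\<lambda>w. if w \<in> z ` I then coord f (x (inv z w)) else 0)" for f
  have c: "coord (S f) w = (if w \<in> z ` I then coord f (x (inv z w)) else 0)" for f w
    unfolding S_def
    using has_sum_imp_summable[OF shift_op_square_sum[OF x z, of I f]]
    by (subst Abs_ell2_inverse) auto
  have "norm (S f) \<le> norm f" for f
  proof -
    have "(norm (S f))\<^sup>2 = (norm (truncate (x ` I) f))\<^sup>2"
      unfolding norm_ell2_square[of "S f"] c by (rule infsumI[OF shift_op_square_sum[OF x z]])
    thus ?thesis using norm_truncate_le[of "x ` I" f] by (simp add: power2_eq_iff_nonneg)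
  qed
  hence "bounded_linear S"
    by (intro bounded_linear_intro[of _ 1]) (auto intro!: ell2_eqI simp: c)
  hence "blinfun_apply (shift_op x z I) = S"
    unfolding shift_op_def S_def by (simp add: bounded_linear_Blinfun_apply)
  thus ?thesis by (simp add: c)
qed

context
  fixes x z :: "'i \<Rightarrow> 'a"
  assumes x: "inj x" and z: "inj z"
begin

lemma shift_op_delta:
  "blinfun_apply (shift_op x z I) (delta (x i)) = (if i \<in> I then delta (z i) else 0)"
  using x z by (intro ell2_eqI) (auto simp: coord_shift_op[OF x z] inj_eq)

lemma clinear_shift_op: "clinear_operator (shift_op x z I)"
  unfolding clinear_operator_def
  by (intro allI ell2_eqI) (simp add: coord_shift_op[OF x z])

lemma matrix_entry_shift_op:
  "matrix_entry (shift_op x z I) p q = (if \<exists>i\<in>I. p = x i \<and> q = z i then 1 else 0)"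
  using x z by (auto simp: matrix_entry_coord coord_shift_op[OF x z] inj_eq)

lemma shift_op_in_uniform_Roe_algebra:
  assumes "range x \<subseteq> X" "range z \<subseteq> X" "\<And>i. d (x i) (z i) \<le> r"
  shows "shift_op x z I \<in> uniform_Roe_algebra X d"
proof (rule uniform_Roe_algebraI)
  have "coord (blinfun_apply (shift_op x z I) f) w = 0" if "w \<notin> X" for f w
    using that assms(2) by (auto simp: coord_shift_op[OF x z])
  moreover have "blinfun_apply (shift_op x z I) f = 0" if "\<forall>w\<in>X. coord f w = 0" for f
    using that assms(1) by (intro ell2_eqI) (auto simp: coord_shift_op[OF x z])
  ultimately show "shift_op x z I \<in> bounded_operators X"
    using clinear_shift_op[of I] by (auto simp: bounded_operators_def clinear_operator_def)
  show "finite_propagation X d (shift_op x z I)"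
    unfolding finite_propagation_def
  proof (intro exI[of _ "max r 1"] conjI ballI impI)
    fix p q assume "max r 1 < d p q"
    thus "matrix_entry (shift_op x z I) p q = 0"
      using assms(3) by (auto simp: matrix_entry_shift_op le_max_iff_disj not_le[symmetric])
  qed simp
qed

end

lemma adj_shift_op:
  assumes "inj x" "inj z" shows "adj (shift_op x z I) = shift_op z x I"
  using assms by (intro adj_eqI clinear_shift_op) (auto simp: matrix_entry_shift_op)

lemma shift_op_compose:
  assumes x: "inj x" and z: "inj z"
  shows "shift_op z x I o\<^sub>L shift_op x z J = shift_op x x (I \<inter> J)"
  using x z by (intro blinfun_eqI ell2_eqI) (auto simp: coord_shift_op inj_eq image_iff)

lemma shift_op_insert:
  assumes x: "inj x" and m: "m \<notin> F"
  shows "shift_op x x (insert m F) = outer (delta (x m)) (delta (x m)) + shift_op x x F"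
  using x m by (intro blinfun_eqI ell2_eqI)
    (auto simp: coord_shift_op inj_eq image_iff blinfun.add_left cinner_delta_right)

section \<open>Rank preserving embeddings are implemented on matrix units\<close>

locale Roe_homomorphism =
  fixes X :: "'a set" and dX :: "'a \<Rightarrow> 'a \<Rightarrow> real"
    and Y :: "'b set" and dY :: "'b \<Rightarrow> 'b \<Rightarrow> real"
    and \<Phi> :: "'a operator \<Rightarrow> 'b operator"
  assumes X: "Metric_space X dX" "uniformly_locally_finite X dX"
    and Y: "Metric_space Y dY" "uniformly_locally_finite Y dY"
    and hom: "star_homomorphism (uniform_Roe_algebra X dX) (uniform_Roe_algebra Y dY) \<Phi>"
begin

lemma Phi_in: "a \<in> uniform_Roe_algebra X dX \<Longrightarrow> \<Phi> a \<in> uniform_Roe_algebra Y dY"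
  using hom by (auto simp: star_homomorphism_def)

lemma Phi_clinear: "a \<in> uniform_Roe_algebra X dX \<Longrightarrow> clinear_operator (\<Phi> a)"
  by (rule uniform_Roe_algebra_clinear[OF Phi_in])

lemma Phi_add: "a \<in> uniform_Roe_algebra X dX \<Longrightarrow> b \<in> uniform_Roe_algebra X dX \<Longrightarrow>
    \<Phi> (a + b) = \<Phi> a + \<Phi> b"
  using hom by (simp add: star_homomorphism_def)

lemma Phi_compose: "a \<in> uniform_Roe_algebra X dX \<Longrightarrow> b \<in> uniform_Roe_algebra X dX \<Longrightarrow>
    \<Phi> (a o\<^sub>L b) = \<Phi> a o\<^sub>L \<Phi> b"
  using hom by (simp add: star_homomorphism_def)

lemma Phi_adj: "a \<in> uniform_Roe_algebra X dX \<Longrightarrow> \<Phi> (adj a) = adj (\<Phi> a)"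
  using hom by (simp add: star_homomorphism_def)

lemma Phi_zero: "\<Phi> 0 = 0"
  using Phi_add[OF zero_in_uniform_Roe_algebra zero_in_uniform_Roe_algebra] by simp

end

text \<open>
  The data extracted from a rank preserving embedding: the linear extension of \<open>delta p \<mapsto> \<xi> p\<close> is an
  isometry, and it implements \<open>\<Phi>\<close> on matrix units. The values of \<open>\<Phi>\<close> on infinite sums of matrix
  units are not determined by this.
\<close>

locale implemented_embedding = Roe_homomorphism X dX Y dY \<Phi>
  for X :: "'a set" and dX :: "'a \<Rightarrow> 'a \<Rightarrow> real"
    and Y :: "'b set" and dY :: "'b \<Rightarrow> 'b \<Rightarrow> real"
    and \<Phi> :: "'a operator \<Rightarrow> 'b operator" +
  fixes \<xi> :: "'a \<Rightarrow> 'b ell2"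
  assumes matrix_unit:
      "\<And>p q. p \<in> X \<Longrightarrow> q \<in> X \<Longrightarrow> \<Phi> (outer (delta p) (delta q)) = outer (\<xi> p) (\<xi> q)"
    and orthonormal: "orthonormal_on X \<xi>"
    and support: "\<And>p y. p \<in> X \<Longrightarrow> y \<notin> Y \<Longrightarrow> coord (\<xi> p) y = 0"

lemma (in implemented_embedding) norm_xi: "p \<in> X \<Longrightarrow> norm (\<xi> p) = 1"
  by (rule orthonormal_on_norm[OF orthonormal])

text \<open>
  Transporting a single unit vector \<open>v\<close> along the row of matrix units at \<open>x0\<close> fixes the phases
  coherently: factoring \<open>e p q = e x0 q \<circ> e x0 x0 \<circ> e p x0\<close>, the middle factor goes to \<open>outer v v\<close>
  and the outer ones move its two vectors to \<open>\<xi> p\<close> and \<open>\<xi> q\<close>.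
\<close>

lemma (in Roe_homomorphism) ex_implementation:
  assumes rank: "rank_preserving (uniform_Roe_algebra X dX) \<Phi>" and x0: "x0 \<in> X"
  shows "\<exists>\<xi>. implemented_embedding X dX Y dY \<Phi> \<xi>"
proof -
  let ?E = "\<lambda>p q. outer (delta p) (delta q) :: 'a operator"
  note E = matrix_unit_in_uniform_Roe_algebra
  have "projection (\<Phi> (?E x0 x0))" "rank_one (\<Phi> (?E x0 x0))"
    using rank E[OF x0 x0] matrix_unit_projection[of x0] unfolding rank_preserving_def by blast+
  then obtain v where v: "norm v = 1" "\<Phi> (?E x0 x0) = outer v v"
    by (rule rank_one_projection[OF _ _ Phi_clinear[OF E[OF x0 x0]]])
  define \<xi> where "\<xi> p = blinfun_apply (\<Phi> (?E x0 p)) v" for p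
  have E_comp: "?E q p' o\<^sub>L ?E p q' = (if q = q' then ?E p p' else 0)" for p q p' q'
    by (intro blinfun_eqI ell2_eqI) (auto simp: cinner_delta_right)
  have E_adj: "adj (?E p q) = ?E q p" for p q
    by (intro adj_eqI clinear_operator_outer) (auto simp: matrix_entry_outer)
  have unit: "\<Phi> (?E p q) = outer (\<xi> p) (\<xi> q)" if "p \<in> X" "q \<in> X" for p q
  proof -
    have "\<Phi> (?E p q) = \<Phi> ((?E x0 q o\<^sub>L ?E x0 x0) o\<^sub>L ?E p x0)" by (simp add: E_comp)
    also have "\<dots> = (\<Phi> (?E x0 q) o\<^sub>L \<Phi> (?E x0 x0)) o\<^sub>L \<Phi> (?E p x0)"
    proof -
      have "?E x0 q o\<^sub>L ?E x0 x0 \<in> uniform_Roe_algebra X dX" by (simp add: E_comp E x0 that)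
      thus ?thesis by (simp add: Phi_compose E x0 that)
    qed
    also have "\<dots> = outer (\<xi> p) (\<xi> q)"
    proof -
      have "adj (\<Phi> (?E p x0)) = \<Phi> (?E x0 p)"
        using Phi_adj[OF E[OF that(1) x0]] by (simp add: E_adj)
      thus ?thesis
        using that x0 by (simp add: v(2) compose_outer outer_compose Phi_clinear E \<xi>_def)
    qed
    finally show ?thesis .
  qed
  have "implemented_embedding X dX Y dY \<Phi> \<xi>"
  proof unfold_locales
    show "orthonormal_on X \<xi>"
      unfolding orthonormal_on_def
    proof (intro ballI)
      fix p q assume pq: "p \<in> X" "q \<in> X"
      have "cinner (\<xi> p) (\<xi> q) = cinner (\<xi> p) (blinfun_apply (\<Phi> (?E x0 q)) v)"
        by (simp add: \<xi>_def)
      also have "\<dots> = cinner (\<xi> p) (blinfun_apply (adj (\<Phi> (?E q x0))) v)"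
        using Phi_adj[OF E[OF pq(2) x0]] by (simp add: E_adj)
      also have "\<dots> = cinner (blinfun_apply (\<Phi> (?E q x0)) (blinfun_apply (\<Phi> (?E x0 p)) v)) v"
        using Phi_clinear[OF E[OF pq(2) x0]] by (simp add: cinner_adj clinear_operator_def \<xi>_def)
      also have "\<dots> = cinner (blinfun_apply (\<Phi> (?E q x0 o\<^sub>L ?E x0 p)) v) v"
        using pq x0 by (simp add: Phi_compose E)
      also have "\<dots> = (if p = q then 1 else 0)"
        using cinner_self[of v] v by (simp add: E_comp Phi_zero cinner_scaleC_left cinner_zero_left)
      finally show "cinner (\<xi> p) (\<xi> q) = (if p = q then 1 else 0)" .
    qed
    show "coord (\<xi> p) y = 0" if "p \<in> X" "y \<notin> Y" for p y
      unfolding \<xi>_def by (rule uniform_Roe_algebra_coord[OF Phi_in[OF E[OF x0 that(1)]] that(2)])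
  qed (rule unit)
  thus ?thesis by blast
qed

section \<open>Strong convergence along an infinite set of indices\<close>

text \<open>
  Code the finite initial segments of each subset \<open>\<alpha>\<close> of the natural numbers by numbers. Distinct
  \<open>\<alpha>\<close> and \<open>\<beta>\<close> share only the segments that end before the first place where they differ.
\<close>

lemma ex_uncountable_almost_disjoint:
  obtains S :: "nat set set" where "uncountable S" "\<And>I. I \<in> S \<Longrightarrow> infinite I"
    "\<And>I J. I \<in> S \<Longrightarrow> J \<in> S \<Longrightarrow> I \<noteq> J \<Longrightarrow> finite (I \<inter> J)"
proof -
  \<comment> \<open>The code determines the length \<open>n\<close> of the segment as well.\<close>
  define c where "c \<alpha> n = to_nat (map (\<lambda>i. i \<in> \<alpha>) [0..<n])" for \<alpha> :: "nat set" and n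
  have c_eq: "n = m \<and> (\<forall>i<n. i \<in> \<alpha> \<longleftrightarrow> i \<in> \<beta>)" if "c \<alpha> n = c \<beta> m" for \<alpha> \<beta> n m
  proof -
    have eq: "map (\<lambda>i. i \<in> \<alpha>) [0..<n] = map (\<lambda>i. i \<in> \<beta>) [0..<m]" using that by (simp add: c_def)
    hence "length [0..<n] = length [0..<m]" by (metis length_map)
    hence "n = m" by simp
    thus ?thesis using eq by simp
  qed
  have inf: "infinite (range (c \<alpha>))" for \<alpha>
    using c_eq by (intro range_inj_infinite) (auto simp: inj_on_def)
  have fin: "finite (range (c \<alpha>) \<inter> range (c \<beta>))" if "\<alpha> \<noteq> \<beta>" for \<alpha> \<beta>
  proof -
    obtain k where k: "(k \<in> \<alpha>) \<noteq> (k \<in> \<beta>)" using \<open>\<alpha> \<noteq> \<beta>\<close> by blast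
    have "range (c \<alpha>) \<inter> range (c \<beta>) \<subseteq> c \<alpha> ` {..k}"
    proof
      fix w assume "w \<in> range (c \<alpha>) \<inter> range (c \<beta>)"
      then obtain n m where w: "w = c \<alpha> n" "c \<alpha> n = c \<beta> m" by auto
      have "n \<le> k" using c_eq[OF w(2)] k by (metis not_le)
      thus "w \<in> c \<alpha> ` {..k}" using w(1) by simp
    qed
    thus ?thesis using finite_subset by blast
  qed
  hence "inj (\<lambda>\<alpha>. range (c \<alpha>))"
    using inf by (intro injI) (metis inf.idem)
  moreover have "uncountable (UNIV :: nat set set)"
    using Cantors_theorem[of "UNIV :: nat set"] by (auto simp: uncountable_def)
  ultimately have "uncountable (range (\<lambda>\<alpha>. range (c \<alpha>)))"
    using countable_image_inj_on by blast
  moreover have "finite (I \<inter> J)"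
    if "I \<in> range (\<lambda>\<alpha>. range (c \<alpha>))" "J \<in> range (\<lambda>\<alpha>. range (c \<alpha>))" "I \<noteq> J" for I J
    using that fin by (elim rangeE) metis
  ultimately show ?thesis
    using inf by (intro that[of "range (\<lambda>\<alpha>. range (c \<alpha>))"]) auto
qed

context implemented_embedding
begin

context
  fixes x z :: "nat \<Rightarrow> 'a" and r :: real
  assumes x: "inj x" "range x \<subseteq> X" and z: "inj z" "range z \<subseteq> X"
    and r: "\<And>n. dX (x n) (z n) \<le> r"
begin

lemma shift_in: "shift_op x z I \<in> uniform_Roe_algebra X dX"
  by (rule shift_op_in_uniform_Roe_algebra[OF x(1) z(1) x(2) z(2)]) (rule r)

lemma shift_in': "shift_op z x I \<in> uniform_Roe_algebra X dX"
proof (rule shift_op_in_uniform_Roe_algebra[OF z(1) x(1) z(2) x(2)])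
  show "dX (z n) (x n) \<le> r" for n
    using r[of n] by (simp add: Metric_space.commute[OF X(1)])
qed

lemma diagonal_shift_in: "shift_op x x I \<in> uniform_Roe_algebra X dX"
proof (rule shift_op_in_uniform_Roe_algebra[OF x(1) x(1) x(2) x(2)])
  show "dX (x n) (x n) \<le> 0" for n
    using x(2) by (subst Metric_space.mdist_zero[OF X(1)]) auto
qed

lemma Phi_shift_xi:
  "blinfun_apply (\<Phi> (shift_op x z I)) (\<xi> (x m)) = (if m \<in> I then \<xi> (z m) else 0)"
proof -
  have xm: "x m \<in> X" and zm: "z m \<in> X" using x z by auto
  note E = matrix_unit_in_uniform_Roe_algebra
  have "\<Phi> (shift_op x z I) o\<^sub>L outer (\<xi> (x m)) (\<xi> (x m))
      = \<Phi> (shift_op x z I o\<^sub>L outer (delta (x m)) (delta (x m)))"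
    by (simp add: Phi_compose[OF shift_in E] matrix_unit xm)
  also have "\<dots> = (if m \<in> I then outer (\<xi> (x m)) (\<xi> (z m)) else 0)"
    by (simp add: compose_outer[OF clinear_shift_op] x z shift_op_delta outer_zero_right
        Phi_zero matrix_unit xm zm)
  finally have "blinfun_apply (\<Phi> (shift_op x z I) o\<^sub>L outer (\<xi> (x m)) (\<xi> (x m))) (\<xi> (x m))
      = blinfun_apply (if m \<in> I then outer (\<xi> (x m)) (\<xi> (z m)) else 0) (\<xi> (x m))" by simp
  moreover have "cinner (\<xi> (x m)) (\<xi> (x m)) = 1"
    using orthonormal xm by (simp add: orthonormal_on_def)
  moreover have "1 *\<^sub>C f = f" for f :: "'b ell2" by (rule ell2_eqI) simp
  ultimately show ?thesis by (simp split: if_splits)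
qed

lemma Phi_finite_diagonal_eq_0:
  assumes "finite F" "\<And>m. m \<in> F \<Longrightarrow> cinner g (\<xi> (x m)) = 0"
  shows "blinfun_apply (\<Phi> (shift_op x x F)) g = 0"
  using assms
proof (induction F)
  case empty
  have "shift_op x x {} = 0"
    using x by (intro blinfun_eqI ell2_eqI) (simp add: coord_shift_op)
  thus ?case by (simp add: Phi_zero)
next
  case (insert m F)
  have "x m \<in> X" using x by auto
  have "\<Phi> (shift_op x x (insert m F)) = outer (\<xi> (x m)) (\<xi> (x m)) + \<Phi> (shift_op x x F)"
    using x insert.hyps(2) \<open>x m \<in> X\<close>
    by (simp add: shift_op_insert Phi_add diagonal_shift_in matrix_unit_in_uniform_Roe_algebra
        matrix_unit)
  moreover have "0 *\<^sub>C f = 0" for f :: "'b ell2" by (rule ell2_eqI) simp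
  ultimately show ?case using insert by (simp add: blinfun.add_left)
qed

text \<open>
  The product \<open>adj (\<Phi> (shift_op x z I)) \<circ> \<Phi> (shift_op x z J)\<close> is the image of the diagonal projection
  over the finite set \<open>I \<inter> J\<close>, hence a finite sum of projections onto the \<open>\<xi> (x m)\<close>, all of which
  vanish on \<open>g\<close>.
\<close>

lemma Phi_shift_orthogonal:
  assumes "finite (I \<inter> J)" "\<And>m. cinner g (\<xi> (x m)) = 0"
  shows "cinner (blinfun_apply (\<Phi> (shift_op x z I)) g) (blinfun_apply (\<Phi> (shift_op x z J)) g) = 0"
proof -
  have "clinear_operator (\<Phi> (shift_op x z I))"
    using shift_in Phi_in uniform_Roe_algebra_clinear by blast
  hence "cinner (blinfun_apply (\<Phi> (shift_op x z I)) g) (blinfun_apply (\<Phi> (shift_op x z J)) g)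
      = cinner g (blinfun_apply (\<Phi> (shift_op z x I) o\<^sub>L \<Phi> (shift_op x z J)) g)"
    using Phi_adj[OF shift_in, of I]
    by (simp add: cinner_adj clinear_operator_def adj_shift_op[OF x(1) z(1)])
  also have "\<Phi> (shift_op z x I) o\<^sub>L \<Phi> (shift_op x z J) = \<Phi> (shift_op x x (I \<inter> J))"
    by (simp add: shift_op_compose[OF x(1) z(1)] flip: Phi_compose[OF shift_in' shift_in])
  also have "blinfun_apply \<dots> g = 0"
    by (rule Phi_finite_diagonal_eq_0) (auto simp: assms)
  finally show ?thesis by (simp add: cinner_zero_right)
qed

text \<open>
  The sum on the left is what \<open>\<Phi> (shift_op x z I)\<close> does on the span of the \<open>\<xi> (x m)\<close>. The defect
  at \<open>y\<close> is therefore \<open>\<Phi> (shift_op x z I)\<close> applied to the component \<open>g\<close> of \<open>delta y\<close>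
  orthogonal to that span. For almost disjoint \<open>I\<close> these defects are orthogonal, so for each pair of
  points only countably many \<open>I\<close> show a defect there, and an uncountable family has a member that
  shows none at any of the countably many pairs.
\<close>

lemma ex_infinite_strongly_convergent:
  "\<exists>I. infinite I \<and> (\<forall>y y'.
     (\<lambda>m. if m \<in> I then cnj (coord (\<xi> (x m)) y) * coord (\<xi> (z m)) y' else 0)
       sums matrix_entry (\<Phi> (shift_op x z I)) y y')"
proof -
  define T where "T I = blinfun_apply (\<Phi> (shift_op x z I))" for I
  obtain S :: "nat set set" where S: "uncountable S" "\<And>I. I \<in> S \<Longrightarrow> infinite I"
    "\<And>I J. I \<in> S \<Longrightarrow> J \<in> S \<Longrightarrow> I \<noteq> J \<Longrightarrow> finite (I \<inter> J)"
    by (rule ex_uncountable_almost_disjoint) (rule that)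
  have "x m \<in> X" for m using x by auto
  hence "orthonormal_on UNIV (\<lambda>m. \<xi> (x m))"
    using orthonormal by (simp add: orthonormal_on_def inj_eq[OF x(1)])
  from orthogonal_remainder[OF this]
  have "\<exists>g. (\<lambda>N. v - (\<Sum>m<N. cinner v (\<xi> (x m)) *\<^sub>C \<xi> (x m))) \<longlonglongrightarrow> g \<and>
      (\<forall>m. cinner g (\<xi> (x m)) = 0)" for v by metis
  then obtain g where g: "\<And>v. (\<lambda>N. v - (\<Sum>m<N. cinner v (\<xi> (x m)) *\<^sub>C \<xi> (x m))) \<longlonglongrightarrow> g v"
    "\<And>v m. cinner (g v) (\<xi> (x m)) = 0" by metis
  define B where "B y y' = {I \<in> S. cinner (delta y') (T I (g (delta y))) \<noteq> 0}" for y y'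
  have "countable (B y y')" for y y'
    unfolding B_def T_def
    by (rule countable_not_orthogonal, rule Phi_shift_orthogonal) (auto simp: S g)
  hence "countable (\<Union>(y, y')\<in>Y \<times> Y. B y y')"
    using uniformly_locally_finite_countable[OF Y] by (intro countable_UN countable_SIGMA) auto
  hence "\<not> S \<subseteq> (\<Union>(y, y')\<in>Y \<times> Y. B y y')" using S(1) countable_subset by blast
  then obtain I where I: "I \<in> S" "\<And>y y'. y \<in> Y \<Longrightarrow> y' \<in> Y \<Longrightarrow> I \<notin> B y y'" by blast
  have "(\<lambda>m. if m \<in> I then cnj (coord (\<xi> (x m)) y) * coord (\<xi> (z m)) y' else 0)
       sums matrix_entry (\<Phi> (shift_op x z I)) y y'" for y y'
  proof (cases "y \<in> Y \<and> y' \<in> Y")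
    case True
    \<comment> \<open>By the choice of \<open>I\<close>, the defect vanishes at this pair of points.\<close>
    have T0: "coord (T I (g (delta y))) y' = 0"
      using I True by (auto simp: B_def cinner_delta_left)
    have lin: "T I (c *\<^sub>C f) = c *\<^sub>C T I f" for c f
      using uniform_Roe_algebra_clinear[OF Phi_in[OF shift_in]] by (simp add: clinear_operator_def T_def)
    have "(\<lambda>N. coord (T I (delta y - (\<Sum>m<N. cinner (delta y) (\<xi> (x m)) *\<^sub>C \<xi> (x m)))) y')
        \<longlonglongrightarrow> coord (T I (g (delta y))) y'"
      unfolding T_def by (intro tendsto_coord blinfun.tendsto tendsto_const g)
    also have "(\<lambda>N. coord (T I (delta y - (\<Sum>m<N. cinner (delta y) (\<xi> (x m)) *\<^sub>C \<xi> (x m)))) y')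
        = (\<lambda>N. matrix_entry (\<Phi> (shift_op x z I)) y y' -
           (\<Sum>m<N. if m \<in> I then cnj (coord (\<xi> (x m)) y) * coord (\<xi> (z m)) y' else 0))"
      using lin Phi_shift_xi[of I]
      by (auto simp: T_def blinfun.diff_right blinfun.sum_right coord_sum matrix_entry_coord
          cinner_delta_left intro!: ext sum.cong)
    finally have "(\<lambda>N. matrix_entry (\<Phi> (shift_op x z I)) y y' -
           (\<Sum>m<N. if m \<in> I then cnj (coord (\<xi> (x m)) y) * coord (\<xi> (z m)) y' else 0)) \<longlonglongrightarrow> 0"
      by (simp only: T0)
    from tendsto_diff[OF tendsto_const[of "matrix_entry (\<Phi> (shift_op x z I)) y y'"] this]
    show ?thesis by (simp add: sums_def)
  next
    case False
    have "x m \<in> X" "z m \<in> X" for m using x z by auto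
    hence "(\<lambda>m. if m \<in> I then cnj (coord (\<xi> (x m)) y) * coord (\<xi> (z m)) y' else 0) = (\<lambda>m. 0)"
      using False support by auto
    moreover have "matrix_entry (\<Phi> (shift_op x z I)) y y' = 0"
      using False uniform_Roe_algebra_delta[OF Phi_in[OF shift_in]]
        uniform_Roe_algebra_coord[OF Phi_in[OF shift_in]]
      by (auto simp: matrix_entry_coord)
    ultimately show ?thesis by simp
  qed
  thus ?thesis using I S(2) by blast
qed

end

end

section \<open>Ghost projections assembled from separated blocks\<close>

text \<open>
  Two orthonormal vectors are at distance \<open>\<surd>2\<close>, so an infinite orthonormal set of fixed vectors
  has no convergent sequence of distinct members.
\<close>

lemma orthonormal_not_compact:
  fixes e :: "'i \<Rightarrow> 'a ell2"
  assumes on: "orthonormal_on I e" and "infinite I" and fixed: "\<And>i. i \<in> I \<Longrightarrow> blinfun_apply a (e i) = e i"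
  shows "\<not> compact_operator a"
proof
  assume "compact_operator a"
  hence sc: "seq_compact (closure (blinfun_apply a ` cball 0 1))"
    by (simp add: compact_operator_def compact_imp_seq_compact)
  obtain s :: "nat \<Rightarrow> 'i" where s: "inj s" "range s \<subseteq> I"
    using \<open>infinite I\<close> infinite_countable_subset by blast
  have "e (s k) \<in> closure (blinfun_apply a ` cball 0 1)" for k
  proof -
    have "s k \<in> I" using s by auto
    hence "e (s k) \<in> blinfun_apply a ` cball 0 1"
      by (intro image_eqI[of _ _ "e (s k)"]) (auto simp: fixed orthonormal_on_norm[OF on])
    thus ?thesis by (rule subsetD[OF closure_subset])
  qed
  hence "\<forall>k. e (s k) \<in> closure (blinfun_apply a ` cball 0 1)" by (rule allI)
  from sc this obtain l r where r: "strict_mono (r :: nat \<Rightarrow> nat)" "((\<lambda>k. e (s k)) \<circ> r) \<longlonglongrightarrow> l"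
    by (rule seq_compactE)
  have "Cauchy ((\<lambda>k. e (s k)) \<circ> r)" by (rule LIMSEQ_imp_Cauchy[OF r(2)])
  then obtain N where "\<And>m n. m \<ge> N \<Longrightarrow> n \<ge> N \<Longrightarrow> dist (e (s (r m))) (e (s (r n))) < 1"
    unfolding Cauchy_def o_def by (meson zero_less_one)
  hence "norm (e (s (r N)) - e (s (r (Suc N)))) < 1" by (simp add: dist_norm)
  moreover have ne: "s (r N) \<noteq> s (r (Suc N))"
    using s(1) r(1) by (simp add: inj_eq strict_mono_eq)
  have mem: "s (r k) \<in> I" for k using s(2) by auto
  have "(norm (e (s (r N)) - e (s (r (Suc N)))))\<^sup>2 = 2"
    using on mem ne
    unfolding power2_norm_eq_inner inner_ell2_def cinner_diff_left cinner_diff_right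
    by (simp add: orthonormal_on_def)
  ultimately show False
    using power_strict_mono[of "norm (e (s (r N)) - e (s (r (Suc N))))" 1 2] by simp
qed

text \<open>
  An operator whose matrix consists of the rank one blocks \<open>outer (\<eta> n) (\<eta> n)\<close>, where the unit
  vectors \<open>\<eta> n\<close> have finite, pairwise disjoint supports \<open>W n\<close>. Since for a given pair of points at
  most one block contributes to the entry, every property of \<open>q\<close> can be read off its matrix.
\<close>

context
  fixes q :: "'b operator" and \<eta> :: "nat \<Rightarrow> 'b ell2" and W :: "nat \<Rightarrow> 'b set" and I :: "nat set"
  assumes q: "clinear_operator q"
    and entry: "\<And>y y'. (\<lambda>n. if n \<in> I then cnj (coord (\<eta> n) y) * coord (\<eta> n) y' else 0)
       sums matrix_entry q y y'"
    and finite_block: "\<And>n. n \<in> I \<Longrightarrow> finite (W n)"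
    and disjoint: "\<And>n m y. n \<in> I \<Longrightarrow> m \<in> I \<Longrightarrow> y \<in> W n \<Longrightarrow> y \<in> W m \<Longrightarrow> n = m"
    and unit: "\<And>n. n \<in> I \<Longrightarrow> norm (\<eta> n) = 1"
    and block_support: "\<And>n y. n \<in> I \<Longrightarrow> y \<notin> W n \<Longrightarrow> coord (\<eta> n) y = 0"
begin

lemma block_entry:
  assumes "n \<in> I" "y \<in> W n"
  shows "matrix_entry q y y' = cnj (coord (\<eta> n) y) * coord (\<eta> n) y'"
proof (rule sums_unique2[OF entry])
  have "(if m \<in> I then cnj (coord (\<eta> m) y) * coord (\<eta> m) y' else 0)
      = (if m = n then cnj (coord (\<eta> m) y) * coord (\<eta> m) y' else 0)" for m
  proof (cases "m = n")
    case True
    thus ?thesis by (simp add: \<open>n \<in> I\<close>)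
  next
    case False
    hence "coord (\<eta> m) y = 0" if "m \<in> I"
      using disjoint[OF that assms(1) _ assms(2)] block_support[OF that, of y] by blast
    thus ?thesis using False by simp
  qed
  hence "(\<lambda>m. if m \<in> I then cnj (coord (\<eta> m) y) * coord (\<eta> m) y' else 0)
      = (\<lambda>m. if m = n then cnj (coord (\<eta> m) y) * coord (\<eta> m) y' else 0)" by (rule ext)
  thus "(\<lambda>m. if m \<in> I then cnj (coord (\<eta> m) y) * coord (\<eta> m) y' else 0)
      sums (cnj (coord (\<eta> n) y) * coord (\<eta> n) y')"
    using sums_single[of n "\<lambda>m. cnj (coord (\<eta> m) y) * coord (\<eta> m) y'"] by (simp only:)
qed

lemma block_entry_outside:
  assumes "\<And>n. n \<in> I \<Longrightarrow> y \<notin> W n"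
  shows "matrix_entry q y y' = 0"
proof (rule sums_unique2[OF entry])
  have "(\<lambda>m. if m \<in> I then cnj (coord (\<eta> m) y) * coord (\<eta> m) y' else 0) = (\<lambda>m. 0)"
    using assms block_support by (intro ext) simp
  thus "(\<lambda>m. if m \<in> I then cnj (coord (\<eta> m) y) * coord (\<eta> m) y' else 0) sums 0"
    by simp
qed

lemma block_entry_hermitian: "matrix_entry q y y' = cnj (matrix_entry q y' y)"
proof (rule sums_unique2[OF entry])
  show "(\<lambda>n. if n \<in> I then cnj (coord (\<eta> n) y) * coord (\<eta> n) y' else 0)
      sums cnj (matrix_entry q y' y)"
    using entry[of y' y, THEN sums_cnj[THEN iffD2]]
    by (simp add: if_distrib[of cnj] mult.commute cong: if_cong)
qed

text \<open>
  Each \<open>\<eta> n\<close> is a finite combination of the basis vectors of its own block, on which \<open>q\<close> acts as the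
  projection onto \<open>\<eta> n\<close>.
\<close>

lemma block_fixed:
  assumes n: "n \<in> I" shows "blinfun_apply q (\<eta> n) = \<eta> n"
proof (rule ell2_eqI)
  fix y
  note fin = finite_block[OF n]
  have tr: "truncate (W n) (\<eta> n) = \<eta> n"
    using block_support[OF n] by (intro ell2_eqI) auto
  have "coord (blinfun_apply q (\<eta> n)) y
      = coord (blinfun_apply q (\<Sum>x\<in>W n. coord (\<eta> n) x *\<^sub>C delta x)) y"
    by (simp add: truncate_finite[OF fin, symmetric] tr)
  also have "\<dots> = (\<Sum>x\<in>W n. coord (\<eta> n) x * matrix_entry q x y)"
    using q by (simp add: clinear_operator_def blinfun.sum_right coord_sum matrix_entry_coord)
  also have "\<dots> = (\<Sum>x\<in>W n. of_real ((cmod (coord (\<eta> n) x))\<^sup>2) * coord (\<eta> n) y)"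
    by (intro sum.cong refl) (simp add: block_entry[OF n] complex_norm_square del: of_real_power)
  also have "\<dots> = of_real ((norm (truncate (W n) (\<eta> n)))\<^sup>2) * coord (\<eta> n) y"
    by (simp add: norm_truncate_finite[OF fin] sum_distrib_right)
  also have "\<dots> = coord (\<eta> n) y" by (simp add: tr unit[OF n])
  finally show "coord (blinfun_apply q (\<eta> n)) y = coord (\<eta> n) y" .
qed

lemma block_projection: "projection q"
  unfolding projection_def
proof
  show "adj q = q" by (rule adj_eqI[OF q q block_entry_hermitian])
  show "q o\<^sub>L q = q"
  proof (rule clinear_operator_eqI[OF clinear_operator_compose[OF q q] q])
    fix y y'
    show "matrix_entry (q o\<^sub>L q) y y' = matrix_entry q y y'"
    proof (cases "\<exists>n\<in>I. y \<in> W n")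
      case True
      then obtain n where n: "n \<in> I" "y \<in> W n" by blast
      have "blinfun_apply q (delta y) = cnj (coord (\<eta> n) y) *\<^sub>C \<eta> n"
        using block_entry[OF n] by (intro ell2_eqI) (simp add: matrix_entry_coord)
      thus ?thesis using q block_fixed[OF n(1)]
        by (simp add: matrix_entry_coord clinear_operator_def)
    next
      case False
      hence "blinfun_apply q (delta y) = 0"
        using block_entry_outside[of y] by (intro ell2_eqI) (simp add: matrix_entry_coord)
      thus ?thesis by (simp add: matrix_entry_coord)
    qed
  qed
qed

lemma block_not_compact:
  assumes "infinite I" shows "\<not> compact_operator q"
proof (rule orthonormal_not_compact[OF _ assms block_fixed])
  show "orthonormal_on I \<eta>"
    unfolding orthonormal_on_def
  proof (intro ballI)
    fix n m assume nm: "n \<in> I" "m \<in> I"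
    show "cinner (\<eta> n) (\<eta> m) = (if n = m then 1 else 0)"
    proof (cases "n = m")
      case False
      have "coord (\<eta> n) y * cnj (coord (\<eta> m) y) = 0" for y
        using disjoint[of n m y] block_support[of n y] block_support[of m y] nm False by auto
      thus ?thesis using False by (simp add: cinner_def infsum_0)
    qed (simp add: cinner_self unit nm)
  qed
qed

text \<open>
  An entry in the block of index \<open>n\<close> is at most \<open>(b n)\<^sup>2\<close>, and only finitely many points lie in the
  blocks where this is not yet small.
\<close>

lemma block_ghost:
  assumes small: "(\<lambda>n. b n) \<longlonglongrightarrow> (0 :: real)" and b: "\<And>n y. n \<in> I \<Longrightarrow> cmod (coord (\<eta> n) y) \<le> b n"
  shows "ghost (\<Union>n\<in>I. W n) q"
  unfolding ghost_def
proof (intro allI impI)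
  fix \<epsilon> :: real assume "\<epsilon> > 0"
  have "(\<lambda>n. b n * b n) \<longlonglongrightarrow> 0 * 0" by (intro tendsto_mult small)
  hence "\<forall>\<^sub>F n in sequentially. b n * b n < \<epsilon>"
    using \<open>\<epsilon> > 0\<close> by (intro order_tendstoD(2)[where y = 0]) auto
  then obtain N where N: "\<And>n. n \<ge> N \<Longrightarrow> b n * b n < \<epsilon>"
    unfolding eventually_sequentially by blast
  show "\<exists>A. finite A \<and> A \<subseteq> (\<Union>n\<in>I. W n) \<and>
      (\<forall>x\<in>(\<Union>n\<in>I. W n) - A. \<forall>y\<in>(\<Union>n\<in>I. W n) - A. cmod (matrix_entry q x y) < \<epsilon>)"
  proof (intro exI[of _ "\<Union>n\<in>I \<inter> {..<N}. W n"] conjI ballI)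
    show "finite (\<Union>n\<in>I \<inter> {..<N}. W n)" by (auto intro: finite_block)
    fix x y assume x: "x \<in> (\<Union>n\<in>I. W n) - (\<Union>n\<in>I \<inter> {..<N}. W n)"
    then obtain n where n: "n \<in> I" "x \<in> W n" by blast
    have "n \<ge> N"
    proof (rule ccontr)
      assume "\<not> n \<ge> N"
      hence "n \<in> I \<inter> {..<N}" using n(1) by simp
      thus False using x n(2) by blast
    qed
    have "cmod (matrix_entry q x y) = cmod (coord (\<eta> n) x) * cmod (coord (\<eta> n) y)"
      by (simp add: block_entry[OF n(1,2)] norm_mult)
    also have "\<dots> \<le> b n * b n"
      using b[OF n(1)] by (intro mult_mono) (auto intro: order_trans[OF norm_ge_zero])
    also have "\<dots> < \<epsilon>" by (rule N[OF \<open>n \<ge> N\<close>])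
    finally show "cmod (matrix_entry q x y) < \<epsilon>" .
  qed auto
qed

lemma block_corner:
  "truncate_op (\<Union>n\<in>I. W n) o\<^sub>L q o\<^sub>L truncate_op (\<Union>n\<in>I. W n) = q"
proof (rule clinear_operator_eqI[OF _ q])
  let ?Z = "\<Union>n\<in>I. W n"
  have "clinear_operator (truncate_op ?Z)"
    unfolding clinear_operator_def by (auto intro!: ell2_eqI)
  thus "clinear_operator (truncate_op ?Z o\<^sub>L q o\<^sub>L truncate_op ?Z)"
    by (intro clinear_operator_compose q)
  fix y y'
  have "truncate ?Z (delta y) = (if y \<in> ?Z then delta y else 0)"
    by (intro ell2_eqI) auto
  moreover have "matrix_entry q y y' = 0" if "y \<notin> ?Z \<or> y' \<notin> ?Z"
    using that block_entry_outside block_entry_hermitian[of y y'] by auto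
  ultimately show "matrix_entry (truncate_op ?Z o\<^sub>L q o\<^sub>L truncate_op ?Z) y y' = matrix_entry q y y'"
    by (auto simp: matrix_entry_coord)
qed

end

context implemented_embedding
begin

text \<open>
  A vector whose coordinates are at most \<open>\<delta>\<close> has norm at most \<open>card V * \<delta>\<close> on the finite
  set \<open>V\<close>, so removing \<open>V\<close> from the support of a good finite approximation costs little.
\<close>

lemma ex_escaping_block:
  assumes small: "\<And>\<delta>. \<delta> > 0 \<Longrightarrow> \<exists>p\<in>X. \<forall>y. cmod (coord (\<xi> p) y) < \<delta>"
    and V: "finite V" and \<epsilon>: "\<epsilon> > 0"
  shows "\<exists>p\<in>X. \<exists>F. finite F \<and> F \<subseteq> Y - V \<and> (\<forall>y. cmod (coord (\<xi> p) y) \<le> \<epsilon>) \<and>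
    norm (\<xi> p - truncate F (\<xi> p)) \<le> \<epsilon>"
proof -
  \<comment> \<open>One half of the error is spent on the finite approximation, the other on removing \<open>V\<close>.\<close>
  define \<delta> where "\<delta> = \<epsilon> / (2 * (card V + 1))"
  have \<delta>: "\<delta> > 0" "\<delta> \<le> \<epsilon>"
    using \<epsilon> by (auto simp: \<delta>_def field_simps intro: mult_nonneg_nonneg)
  from small[OF \<delta>(1)] obtain p where p: "p \<in> X" "\<And>y. cmod (coord (\<xi> p) y) < \<delta>" by blast
  have "\<epsilon> / 2 > 0" using \<epsilon> by simp
  then obtain F where F: "finite F" "norm (\<xi> p - truncate F (\<xi> p)) < \<epsilon> / 2"
    by (rule ex_finite_truncate)
  define G where "G = F \<inter> Y - V"
  have "\<xi> p - truncate G (\<xi> p) = (\<xi> p - truncate F (\<xi> p)) + truncate (F \<inter> V) (\<xi> p)"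
    using support[OF p(1)] by (intro ell2_eqI) (auto simp: G_def)
  hence "norm (\<xi> p - truncate G (\<xi> p))
      \<le> norm (\<xi> p - truncate F (\<xi> p)) + norm (truncate (F \<inter> V) (\<xi> p))"
    by (simp only: norm_triangle_ineq)
  also have "norm (truncate (F \<inter> V) (\<xi> p)) \<le> norm (truncate V (\<xi> p))"
    by (rule norm_mono_coord) auto
  also have "\<dots> \<le> card V * \<delta>"
  proof (rule power2_le_imp_le)
    have "(norm (truncate V (\<xi> p)))\<^sup>2 = (\<Sum>y\<in>V. (cmod (coord (\<xi> p) y))\<^sup>2)"
      by (rule norm_truncate_finite[OF V])
    also have "\<dots> \<le> (\<Sum>y\<in>V. \<delta>\<^sup>2)"
      using p(2) by (intro sum_mono power_mono) (auto intro: less_imp_le)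
    also have "\<dots> \<le> (card V * \<delta>)\<^sup>2"
      using self_le_power[of "real (card V)" 2] 
      by (cases "card V = 0") (auto simp: power_mult_distrib intro!: mult_right_mono)
    finally show "(norm (truncate V (\<xi> p)))\<^sup>2 \<le> (card V * \<delta>)\<^sup>2" .
  qed (use \<delta> in simp)
  also have "card V * \<delta> \<le> \<epsilon> / 2"
    using \<epsilon> by (simp add: \<delta>_def field_simps)
  finally have "norm (\<xi> p - truncate G (\<xi> p)) \<le> \<epsilon>" using F(2) by simp
  moreover have "finite G" "G \<subseteq> Y - V" using F(1) by (auto simp: G_def)
  moreover have "cmod (coord (\<xi> p) y) \<le> \<epsilon>" for y using p(2)[of y] \<delta>(2) by linarith
  ultimately show ?thesis
    using p(1) by (intro bexI[of _ p] exI[of _ G] conjI allI)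
qed

text \<open>
  Inductive choice: the block of index \<open>n\<close> avoids the finite set of points within distance \<open>n\<close> of the
  earlier blocks.
\<close>

lemma ex_escaping_sequence:
  assumes small: "\<And>\<delta>. \<delta> > 0 \<Longrightarrow> \<exists>p\<in>X. \<forall>y. cmod (coord (\<xi> p) y) < \<delta>"
  obtains x :: "nat \<Rightarrow> 'a" and W :: "nat \<Rightarrow> 'b set"
  where "\<And>n. x n \<in> X" "\<And>n. finite (W n)" "\<And>n. W n \<subseteq> Y"
    "\<And>n y. cmod (coord (\<xi> (x n)) y) \<le> (1/2)^(n+2)"
    "\<And>n. norm (\<xi> (x n) - truncate (W n) (\<xi> (x n))) \<le> (1/2)^(n+2)"
    "\<And>n m y y'. m < n \<Longrightarrow> y \<in> W m \<Longrightarrow> y' \<in> W n \<Longrightarrow> dY y y' > real n"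
proof -
  define P where "P f n r \<longleftrightarrow> fst r \<in> X \<and> finite (snd r) \<and> snd r \<subseteq> Y \<and>
      (\<forall>y. cmod (coord (\<xi> (fst r)) y) \<le> (1/2)^(n+2)) \<and>
      norm (\<xi> (fst r) - truncate (snd r) (\<xi> (fst r))) \<le> (1/2)^(n+2) \<and>
      (\<forall>m<n. \<forall>y\<in>snd (f m). \<forall>y'\<in>snd r. dY y y' > real n)"
    for f :: "nat \<Rightarrow> 'a \<times> 'b set" and n r
  have "\<exists>f. \<forall>n. P f n (f n)"
  proof (rule dependent_wellorder_choice)
    show "P f n r = P g n r" if "\<And>y. y < n \<Longrightarrow> f y = g y" for f g n r
      using that by (simp add: P_def)
    fix n and f :: "nat \<Rightarrow> 'a \<times> 'b set"
    assume IH: "\<And>m. m < n \<Longrightarrow> P f m (f m)"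
    define V where "V = (\<Union>m<n. snd (f m))"
    have "finite (snd (f m))" "snd (f m) \<subseteq> Y" if "m < n" for m
      using IH[OF that] unfolding P_def by blast+
    hence V: "finite V" "V \<subseteq> Y" by (auto simp: V_def)
    have "(1/2 :: real)^(n+2) > 0" by simp
    from ex_escaping_block[OF small finite_neighbourhood[OF Y V(1), of "real n"] this]
    obtain p F where F: "p \<in> X" "finite F" "F \<subseteq> Y - {y' \<in> Y. \<exists>y\<in>V \<inter> Y. dY y y' \<le> real n}"
      "\<forall>y. cmod (coord (\<xi> p) y) \<le> (1/2)^(n+2)" "norm (\<xi> p - truncate F (\<xi> p)) \<le> (1/2)^(n+2)"
      by blast
    have "dY y y' > real n" if "m < n" "y \<in> snd (f m)" "y' \<in> F" for m y y'
    proof -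
      have "y \<in> V \<inter> Y" using that V(2) by (auto simp: V_def)
      moreover have "y' \<in> Y" "y' \<notin> {y' \<in> Y. \<exists>y\<in>V \<inter> Y. dY y y' \<le> real n}"
        using F(3) that(3) by auto
      ultimately have "\<not> dY y y' \<le> real n" by blast
      thus ?thesis by simp
    qed
    hence "P f n (p, F)" using F by (auto simp: P_def)
    thus "\<exists>r. P f n r" by blast
  qed
  then obtain f where f: "\<And>n. P f n (f n)" by blast
  show ?thesis
  proof (rule that[of "\<lambda>n. fst (f n)" "\<lambda>n. snd (f n)"])
    fix n
    show "fst (f n) \<in> X" "finite (snd (f n))" "snd (f n) \<subseteq> Y"
      "\<And>y. cmod (coord (\<xi> (fst (f n))) y) \<le> (1/2)^(n+2)"
      "norm (\<xi> (fst (f n)) - truncate (snd (f n)) (\<xi> (fst (f n)))) \<le> (1/2)^(n+2)"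
      using f[of n] unfolding P_def by (elim conjE; simp only:)+
  next
    fix n m y y' assume "m < n" "y \<in> snd (f m)" "y' \<in> snd (f n)"
    thus "dY y y' > real n" using f[of n] unfolding P_def by blast
  qed
qed

text \<open>
  The pieces of the partition are the blocks with index in \<open>I\<close>, the other pieces being empty, so
  that restricting to \<open>I\<close> needs no renumbering. Points in different blocks are further apart than
  the larger index, which is at least half of the sum of the indices.
\<close>

lemma sparse_blocks:
  assumes "\<And>n. finite (W n)" "\<And>n. W n \<subseteq> Y"
    and far: "\<And>n m y y'. m < n \<Longrightarrow> y \<in> W m \<Longrightarrow> y' \<in> W n \<Longrightarrow> dY y y' > real n"
  shows "sparse_space (\<Union>n\<in>I. W n) dY"
    and "n \<noteq> m \<Longrightarrow> W n \<inter> W m = {}"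
proof -
  have far': "dY y y' > real (max n m)" if "n \<noteq> m" "y \<in> W n" "y' \<in> W m" for n m y y'
    using that far[of n m y y'] far[of m n y' y]
    by (cases "n < m") (auto simp: max_def Metric_space.commute[OF Y(1)])
  show dis: "W n \<inter> W m = {}" if "n \<noteq> m" for n m
  proof (rule ccontr)
    assume "W n \<inter> W m \<noteq> {}"
    then obtain y where y: "y \<in> W n" "y \<in> W m" by blast
    have "y \<in> Y" using y assms(2) by blast
    hence "dY y y = 0" by (simp add: Metric_space.mdist_zero[OF Y(1)])
    thus False using far'[OF that y] by simp
  qed
  define P where "P n = (if n \<in> I then W n else {})" for n
  have "\<exists>N. \<forall>n m. n \<noteq> m \<and> n + m \<ge> N \<longrightarrow> (\<forall>x\<in>P n. \<forall>y\<in>P m. dY x y \<ge> R)" for R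
  proof (intro exI[of _ "2 * nat \<lceil>R\<rceil>"] allI impI ballI)
    fix n m x y assume nm: "n \<noteq> m \<and> n + m \<ge> 2 * nat \<lceil>R\<rceil>" "x \<in> P n" "y \<in> P m"
    have "dY x y > real (max n m)"
      using nm by (intro far') (auto simp: P_def split: if_splits)
    moreover have "nat \<lceil>R\<rceil> \<le> max n m" using nm(1) by linarith
    hence "R \<le> real (max n m)" by (simp add: nat_le_iff ceiling_le_iff)
    ultimately show "dY x y \<ge> R" by linarith
  qed
  moreover have "(\<Union>n. P n) = (\<Union>n\<in>I. W n)" by (auto simp: P_def split: if_splits)
  moreover have "disjoint_family P" using dis by (auto simp: disjoint_family_on_def P_def)
  moreover have "\<forall>n. finite (P n)" by (simp add: P_def assms(1))
  ultimately show "sparse_space (\<Union>n\<in>I. W n) dY" unfolding sparse_space_def by blast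
qed

text \<open>
  If there were no lower bound, one could take an escaping sequence, truncate its vectors to their
  blocks and normalise them to \<open>\<eta> n\<close>. The operator \<open>q = \<Sum>n\<in>I. outer (\<eta> n) (\<eta> n)\<close> is obtained from
  the image of a diagonal projection by subtracting the norm convergent series of the differences
  \<open>outer (\<xi> (x n)) (\<xi> (x n)) - outer (\<eta> n) (\<eta> n)\<close>. It is a ghost projection of infinite rank that
  lives on a sparse subspace, contrary to the hypothesis.
\<close>

lemma coord_lower_bound:
  assumes ghosts: "\<forall>S\<subseteq>Y. sparse_space S dY \<longrightarrow> only_compact_ghost_projections S dY"
  shows "\<exists>\<delta>>0. \<forall>p\<in>X. \<exists>y\<in>Y. cmod (coord (\<xi> p) y) \<ge> \<delta>"
proof (rule ccontr)
  assume contra: "\<not> ?thesis"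
  have "\<exists>p\<in>X. \<forall>y. cmod (coord (\<xi> p) y) < \<delta>" if "\<delta> > 0" for \<delta>
  proof -
    have "\<not> (\<forall>p\<in>X. \<exists>y\<in>Y. cmod (coord (\<xi> p) y) \<ge> \<delta>)" using contra that by blast
    then obtain p where p: "p \<in> X" "\<And>y. y \<in> Y \<Longrightarrow> cmod (coord (\<xi> p) y) < \<delta>"
      unfolding not_le[symmetric] by blast
    have "cmod (coord (\<xi> p) y) < \<delta>" for y
      using p(2)[of y] support[OF p(1), of y] that by (cases "y \<in> Y") auto
    thus ?thesis using p(1) by blast
  qed
  then obtain x W where x: "\<And>n. x n \<in> X" and W: "\<And>n. finite (W n)" "\<And>n. W n \<subseteq> Y"
    and small: "\<And>n y. cmod (coord (\<xi> (x n)) y) \<le> (1/2)^(n+2)"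
    and approx: "\<And>n. norm (\<xi> (x n) - truncate (W n) (\<xi> (x n))) \<le> (1/2)^(n+2)"
    and far: "\<And>n m y y'. m < n \<Longrightarrow> y \<in> W m \<Longrightarrow> y' \<in> W n \<Longrightarrow> dY y y' > real n"
    using ex_escaping_sequence by metis
  have dis: "W n \<inter> W m = {}" if "n \<noteq> m" for n m
    by (rule sparse_blocks(2)[OF W far that])
  define w where "w n = truncate (W n) (\<xi> (x n))" for n
  define \<eta> where "\<eta> n = complex_of_real (1 / norm (w n)) *\<^sub>C w n" for n
  have quarter: "(1/2 :: real)^(n+2) \<le> 1/4" for n
    using power_decreasing[of 2 "n + 2" "1/2 :: real"] by (simp add: power2_eq_square)
  have nw: "1 - (1/2)^(n+2) \<le> norm (w n)" "norm (w n) \<le> 1" for n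
  proof -
    have "norm (\<xi> (x n)) \<le> norm (w n) + norm (\<xi> (x n) - w n)"
      using norm_triangle_ineq[of "w n" "\<xi> (x n) - w n"] by simp
    thus "1 - (1/2)^(n+2) \<le> norm (w n)" using approx[of n] norm_xi[OF x] by (simp add: w_def)
    show "norm (w n) \<le> 1" using norm_truncate_le[of "W n"] norm_xi[OF x] by (metis w_def)
  qed
  have nw_half: "norm (w n) \<ge> 1/2" for n using nw(1)[of n] quarter[of n] by linarith
  have unit: "norm (\<eta> n) = 1" for n
  proof -
    have "w n \<noteq> 0" using nw_half[of n] by auto
    thus ?thesis by (simp add: \<eta>_def norm_scaleC norm_divide)
  qed
  have supp: "coord (\<eta> n) y = 0" if "y \<notin> W n" for n y
    using that by (simp add: \<eta>_def w_def)
  have "inj x"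
  proof (rule injI)
    fix m n assume eq: "x m = x n"
    show "m = n"
    proof (rule ccontr)
      assume "m \<noteq> n"
      \<comment> \<open>The part of \<open>\<xi> (x n)\<close> in the disjoint block \<open>W m\<close> belongs to the small remainder of \<open>w n\<close>.\<close>
      hence "w m = truncate (W m) (\<xi> (x n) - w n)"
        using dis[of m n] eq by (intro ell2_eqI) (auto simp: w_def)
      hence "norm (w m) \<le> norm (\<xi> (x n) - w n)" by (simp add: norm_truncate_le)
      thus False using approx[of n] quarter[of n] nw_half[of m] by (simp add: w_def)
    qed
  qed
  moreover have rx: "range x \<subseteq> X" using x by blast
  moreover have "dX (x n) (x n) \<le> 0" for n using x by (simp add: Metric_space.mdist_zero[OF X(1)])
  ultimately obtain I where I: "infinite I"
    "\<And>y y'. (\<lambda>m. if m \<in> I then cnj (coord (\<xi> (x m)) y) * coord (\<xi> (x m)) y' else 0)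
       sums matrix_entry (\<Phi> (shift_op x x I)) y y'"
    using ex_infinite_strongly_convergent[of x x 0] by blast
  define D where "D n = (if n \<in> I then outer (\<xi> (x n)) (\<xi> (x n)) - outer (\<eta> n) (\<eta> n) else 0)" for n
  have D_in: "D n \<in> uniform_Roe_algebra Y dY" for n
  proof -
    have "outer (\<xi> (x n)) (\<xi> (x n)) \<in> uniform_Roe_algebra Y dY"
      using Phi_in[OF matrix_unit_in_uniform_Roe_algebra[OF x x]] by (simp add: matrix_unit x)
    moreover have "outer (\<eta> n) (\<eta> n) \<in> uniform_Roe_algebra Y dY"
      by (rule finite_support_in_uniform_Roe_algebra[OF W supp supp])
    ultimately show ?thesis
      by (simp add: D_def uniform_Roe_algebra_diff zero_in_uniform_Roe_algebra)
  qed
  have nD: "norm (D n) \<le> (1/2)^n" for n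
  proof -
    have "w n - \<eta> n = complex_of_real (1 - 1 / norm (w n)) *\<^sub>C w n"
      by (intro ell2_eqI) (simp add: \<eta>_def algebra_simps)
    hence "norm (w n - \<eta> n) = \<bar>1 - 1 / norm (w n)\<bar> * norm (w n)"
      by (simp only: norm_scaleC norm_of_real)
    also have "\<dots> = 1 - norm (w n)"
    proof -
      have p: "norm (w n) > 0" using nw_half[of n] by linarith
      hence "\<bar>1 - 1 / norm (w n)\<bar> = 1 / norm (w n) - 1" using nw(2)[of n] by simp
      thus ?thesis using p by (simp add: field_simps)
    qed
    also have "\<dots> \<le> (1/2)^(n+2)" using nw(1)[of n] by simp
    finally have "norm (\<xi> (x n) - \<eta> n) \<le> 2 * (1/2)^(n+2)"
      using norm_triangle_ineq[of "\<xi> (x n) - w n" "w n - \<eta> n"] approx[of n] by (simp add: w_def)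
    moreover have "norm (outer (\<xi> (x n)) (\<xi> (x n)) - outer (\<eta> n) (\<eta> n)) \<le> 2 * norm (\<xi> (x n) - \<eta> n)"
      by (rule norm_outer_diff_le[OF norm_xi[OF x] unit])
    ultimately show ?thesis by (simp add: D_def)
  qed
  have summable: "summable D"
    by (rule summable_comparison_test[of _ "\<lambda>n. (1/2)^n"]) (use nD in auto)
  define q where "q = \<Phi> (shift_op x x I) - suminf D"
  have shift: "shift_op x x I \<in> uniform_Roe_algebra X dX"
    by (rule shift_op_in_uniform_Roe_algebra[where r = 0])
      (use \<open>inj x\<close> rx x in \<open>auto simp: Metric_space.mdist_zero[OF X(1)]\<close>)
  have q_in: "q \<in> uniform_Roe_algebra Y dY"
    unfolding q_def
    by (intro uniform_Roe_algebra_diff Phi_in[OF shift] uniform_Roe_algebra_suminf D_in summable)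
  have q_lin: "clinear_operator q" by (rule uniform_Roe_algebra_clinear[OF q_in])
  have entry: "(\<lambda>n. if n \<in> I then cnj (coord (\<eta> n) y) * coord (\<eta> n) y' else 0)
       sums matrix_entry q y y'" for y y'
  proof -
    have "(\<lambda>n. matrix_entry (D n) y y') sums matrix_entry (suminf D) y y'"
      by (rule bounded_linear.sums[OF bounded_linear_matrix_entry summable_sums[OF summable]])
    from sums_diff[OF I(2) this]
    have "(\<lambda>n. (if n \<in> I then cnj (coord (\<xi> (x n)) y) * coord (\<xi> (x n)) y' else 0)
        - matrix_entry (D n) y y') sums matrix_entry q y y'"
      by (simp add: q_def matrix_entry_coord blinfun.diff_left)
    also have "(\<lambda>n. (if n \<in> I then cnj (coord (\<xi> (x n)) y) * coord (\<xi> (x n)) y' else 0)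
        - matrix_entry (D n) y y')
        = (\<lambda>n. if n \<in> I then cnj (coord (\<eta> n) y) * coord (\<eta> n) y' else 0)"
      by (intro ext)
        (simp add: D_def matrix_entry_coord blinfun.diff_left cinner_delta_left)
    finally show ?thesis .
  qed
  have disj: "n = m" if "y \<in> W n" "y \<in> W m" for n m y using dis[of n m] that by blast
  note blocks = q_lin entry W(1) disj unit supp
  let ?Z = "\<Union>n\<in>I. W n"
  have "truncate_op ?Z o\<^sub>L q o\<^sub>L truncate_op ?Z = q"
    by (rule block_corner[where \<eta> = \<eta>]) (use blocks in auto)
  moreover have "?Z \<subseteq> Y" using W(2) by blast
  ultimately have "q \<in> uniform_Roe_algebra ?Z dY"
    using corner_in_uniform_Roe_algebra[OF q_in, of ?Z] by simp
  moreover have "projection q"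
    by (rule block_projection[where \<eta> = \<eta> and W = W and I = I]) (use blocks in auto)
  moreover have "ghost ?Z q"
  proof (rule block_ghost[where \<eta> = \<eta>])
    show "(\<lambda>n. 2 * (1/2 :: real)^(n+2)) \<longlonglongrightarrow> 0"
      using LIMSEQ_power_zero[of "1/2 :: real"]
      by simp
    show "cmod (coord (\<eta> n) y) \<le> 2 * (1/2)^(n+2)" for n y
    proof -
      have "cmod (coord (\<eta> n) y) = cmod (coord (w n) y) / norm (w n)"
        by (simp add: \<eta>_def norm_divide)
      also have "\<dots> \<le> (1/2)^(n+2) / (1/2)"
        using small[of n y] nw_half[of n] by (intro frac_le) (auto simp: w_def)
      finally show ?thesis by simp
    qed
  qed (use blocks in auto)
  moreover have "sparse_space ?Z dY" by (rule sparse_blocks(1)[OF W far])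
  ultimately have "compact_operator q"
    using ghosts \<open>?Z \<subseteq> Y\<close> unfolding only_compact_ghost_projections_def by blast
  moreover have "\<not> compact_operator q"
    by (rule block_not_compact[where \<eta> = \<eta> and W = W and I = I]) (use blocks I(1) in auto)
  ultimately show False by simp
qed

end

section \<open>The peak map\<close>

context implemented_embedding
begin

lemma peak_uniformly_finite_to_one:
  assumes "\<delta> > 0" and f: "\<And>p. p \<in> X \<Longrightarrow> cmod (coord (\<xi> p) (f p)) \<ge> \<delta>"
  shows "finite {p \<in> X. f p = y}" and "card {p \<in> X. f p = y} \<le> nat \<lfloor>1 / \<delta>\<^sup>2\<rfloor>"
proof -
  have sub: "{p \<in> X. f p = y} \<subseteq> {p \<in> X. cmod (coord (\<xi> p) y) \<ge> \<delta>}"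
    using f by auto
  note fin = orthonormal_on_coord_le[OF orthonormal \<open>\<delta> > 0\<close>, of y]
  show "finite {p \<in> X. f p = y}" by (rule finite_subset[OF sub fin(1)])
  show "card {p \<in> X. f p = y} \<le> nat \<lfloor>1 / \<delta>\<^sup>2\<rfloor>"
    using card_mono[OF fin(1) sub] fin(2) by linarith
qed

text \<open>
  Only finitely many pairs of points at distance at most \<open>r\<close> meet the finite set \<open>B\<close>.
\<close>

lemma peaks_bounded_near_finite_set:
  assumes "finite B"
  obtains K where "\<And>p p'. p \<in> X \<Longrightarrow> p' \<in> X \<Longrightarrow> dX p p' \<le> r \<Longrightarrow> p \<in> B \<or> p' \<in> B \<Longrightarrow>
    dY (f p) (f p') \<le> K"
proof -
  define N where "N = {p \<in> X. \<exists>b\<in>B \<inter> X. dX b p \<le> r}"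
  have "finite N" unfolding N_def by (rule finite_neighbourhood[OF X assms])
  hence fin: "finite ((\<lambda>(p, p'). dY (f p) (f p')) ` ((B \<union> N) \<times> (B \<union> N)))"
    using assms by simp
  define K where "K = Max (insert 0 ((\<lambda>(p, p'). dY (f p) (f p')) ` ((B \<union> N) \<times> (B \<union> N))))"
  have "dY (f p) (f p') \<le> K" if "p \<in> X" "p' \<in> X" "dX p p' \<le> r" "p \<in> B \<or> p' \<in> B" for p p'
  proof -
    have "p \<in> B \<union> N \<and> p' \<in> B \<union> N"
    proof (cases "p \<in> B")
      case True
      thus ?thesis using that by (auto simp: N_def)
    next
      case False
      hence "p' \<in> B" "dX p' p \<le> r" using that Metric_space.commute[OF X(1)] by auto
      thus ?thesis using that by (auto simp: N_def)
    qed
    thus ?thesis unfolding K_def using fin by (intro Max_ge) auto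
  qed
  thus ?thesis using that by blast
qed

text \<open>
  Given the earlier pairs, the new one has to avoid a finite set \<open>B\<close>: the points already used, the
  points whose peak is at a large coordinate of an earlier \<open>\<xi> (x m)\<close> (finitely many, because \<open>\<xi> (x m)\<close>
  has few large coordinates and \<open>f\<close> has finite fibres), and the points \<open>p\<close> for which \<open>\<xi> p\<close> is large
  at an earlier peak (finitely many by Bessel). Pairs meeting \<open>B\<close> have images at bounded distance,
  so a pair with sufficiently distant images avoids it.
\<close>

lemma ex_gliding_pairs:
  assumes "\<delta> > 0" and f: "\<And>p. p \<in> X \<Longrightarrow> cmod (coord (\<xi> p) (f p)) \<ge> \<delta>"
    and unbounded: "\<And>K. \<exists>p\<in>X. \<exists>p'\<in>X. dX p p' \<le> r \<and> dY (f p) (f p') > K"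
    and \<epsilon>: "\<And>n. \<epsilon> n > 0"
  obtains x z :: "nat \<Rightarrow> 'a"
  where "\<And>n. x n \<in> X" "\<And>n. z n \<in> X" "inj x" "inj z" "\<And>n. dX (x n) (z n) \<le> r"
    "\<And>n. dY (f (x n)) (f (z n)) > real n"
    "\<And>m n. m < n \<Longrightarrow> cmod (coord (\<xi> (x m)) (f (x n))) < \<epsilon> n"
    "\<And>m n. m < n \<Longrightarrow> cmod (coord (\<xi> (x n)) (f (x m))) < \<epsilon> n"
proof -
  define P where "P g n s \<longleftrightarrow> fst s \<in> X \<and> snd s \<in> X \<and> dX (fst s) (snd s) \<le> r \<and>
      dY (f (fst s)) (f (snd s)) > real n \<and>
      (\<forall>m<n. fst s \<noteq> fst (g m) \<and> snd s \<noteq> snd (g m) \<and>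
        cmod (coord (\<xi> (fst (g m))) (f (fst s))) < \<epsilon> n \<and>
        cmod (coord (\<xi> (fst s)) (f (fst (g m)))) < \<epsilon> n)"
    for g :: "nat \<Rightarrow> 'a \<times> 'a" and n s
  \<comment> \<open>\<open>P g n s\<close>: the pair \<open>s\<close> may serve as the \<open>n\<close>-th one after \<open>g 0, \<dots>, g (n - 1)\<close>.\<close>
  have "\<exists>g. \<forall>n. P g n (g n)"
  proof (rule dependent_wellorder_choice)
    show "P f n s = P g n s" if "\<And>m. m < n \<Longrightarrow> f m = g m" for f g n s
      using that by (simp add: P_def)
    fix n and g :: "nat \<Rightarrow> 'a \<times> 'a"
    define C where "C m = {fst (g m), snd (g m)}
        \<union> (\<Union>y\<in>{y. cmod (coord (\<xi> (fst (g m))) y) \<ge> \<epsilon> n}. {p \<in> X. f p = y})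
        \<union> {p \<in> X. cmod (coord (\<xi> p) (f (fst (g m)))) \<ge> \<epsilon> n}" for m
    define B where "B = (\<Union>m<n. C m)"
    have "finite B"
      unfolding B_def C_def
      by (intro finite_UN_I finite_UnI finite_insert[THEN iffD2] finite.emptyI finite_lessThan
          finite_large_coord \<epsilon> peak_uniformly_finite_to_one(1)[OF assms(1) f]
          orthonormal_on_coord_le(1)[OF orthonormal])
    then obtain K where K: "\<And>p p'. p \<in> X \<Longrightarrow> p' \<in> X \<Longrightarrow> dX p p' \<le> r \<Longrightarrow> p \<in> B \<or> p' \<in> B \<Longrightarrow>
        dY (f p) (f p') \<le> K"
      by (rule peaks_bounded_near_finite_set[where f = f and r = r]) (rule that)
    obtain p p' where p: "p \<in> X" "p' \<in> X" "dX p p' \<le> r" "dY (f p) (f p') > max K (real n)"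
      using unbounded by blast
    have "\<not> (p \<in> B \<or> p' \<in> B)" using K[OF p(1-3)] p(4) by auto
    hence "p \<notin> B" "p' \<notin> B" by auto
    hence "p \<noteq> fst (g m) \<and> p' \<noteq> snd (g m) \<and> cmod (coord (\<xi> (fst (g m))) (f p)) < \<epsilon> n \<and>
        cmod (coord (\<xi> p) (f (fst (g m)))) < \<epsilon> n" if "m < n" for m
    proof -
      have "p \<notin> C m" "p' \<notin> C m" using \<open>p \<notin> B\<close> \<open>p' \<notin> B\<close> that by (auto simp: B_def)
      thus ?thesis using p(1) by (auto simp: C_def not_le)
    qed
    hence "P g n (p, p')" using p by (auto simp: P_def)
    thus "\<exists>s. P g n s" by blast
  qed
  then obtain g where g: "\<And>n. P g n (g n)" by blast
  have ne: "fst (g m) \<noteq> fst (g n) \<and> snd (g m) \<noteq> snd (g n)" if "m < n" for m n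
    using g[of n] that unfolding P_def by metis
  show ?thesis
  proof (rule that[of "\<lambda>n. fst (g n)" "\<lambda>n. snd (g n)"])
    fix n
    show "fst (g n) \<in> X" "snd (g n) \<in> X" "dX (fst (g n)) (snd (g n)) \<le> r"
      "dY (f (fst (g n))) (f (snd (g n))) > real n"
      using g[of n] unfolding P_def by (elim conjE; simp only:)+
  next
    fix m n :: nat assume "m < n"
    thus "cmod (coord (\<xi> (fst (g m))) (f (fst (g n)))) < \<epsilon> n"
      "cmod (coord (\<xi> (fst (g n))) (f (fst (g m)))) < \<epsilon> n"
      using g[of n] unfolding P_def by blast+
  next
    show "inj (\<lambda>n. fst (g n))" by (rule injI) (metis ne linorder_neqE_nat)
    show "inj (\<lambda>n. snd (g n))" by (rule injI) (metis ne linorder_neqE_nat)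
  qed
qed

text \<open>
  The entry at \<open>(f (x n), f (z n))\<close> is a sum over \<open>m \<in> I\<close> whose term \<open>m = n\<close> has modulus at least
  \<open>\<delta>\<^sup>2\<close>. The gliding pairs are chosen with tolerances \<open>\<epsilon> m\<close> of total \<open>\<delta>\<^sup>2 / 2\<close> so that the other
  terms cannot cancel it.
\<close>

lemma peak_coarse:
  assumes "\<delta> > 0" and f: "\<And>p. p \<in> X \<Longrightarrow> f p \<in> Y"
    "\<And>p. p \<in> X \<Longrightarrow> cmod (coord (\<xi> p) (f p)) \<ge> \<delta>"
  shows "coarse_map X dX dY f"
  unfolding coarse_map_def
proof (intro allI impI, rule ccontr)
  fix r :: real assume "\<not> bdd_above {dY (f p) (f p') | p p'. p \<in> X \<and> p' \<in> X \<and> dX p p' \<le> r}"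
  hence unbounded: "\<exists>p\<in>X. \<exists>p'\<in>X. dX p p' \<le> r \<and> dY (f p) (f p') > K" for K
    unfolding bdd_above_def not_le[symmetric] by blast
  define \<epsilon> where "\<epsilon> n = \<delta>\<^sup>2 / 4 * (1/2)^n" for n
  have \<epsilon>: "\<epsilon> n > 0" for n using \<open>\<delta> > 0\<close> by (simp add: \<epsilon>_def)
  obtain x z where x: "\<And>n. x n \<in> X" "inj x" and z: "\<And>n. z n \<in> X" "inj z"
    and r: "\<And>n. dX (x n) (z n) \<le> r" and far: "\<And>n. dY (f (x n)) (f (z n)) > real n"
    and small: "\<And>m n. m < n \<Longrightarrow> cmod (coord (\<xi> (x m)) (f (x n))) < \<epsilon> n"
      "\<And>m n. m < n \<Longrightarrow> cmod (coord (\<xi> (x n)) (f (x m))) < \<epsilon> n"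
    by (rule ex_gliding_pairs[of \<delta> f r \<epsilon>, OF assms(1) f(2) unbounded \<epsilon>]) (assumption, rule that)
  have rx: "range x \<subseteq> X" and rz: "range z \<subseteq> X" using x(1) z(1) by auto
  obtain I where I: "infinite I"
    "\<And>y y'. (\<lambda>m. if m \<in> I then cnj (coord (\<xi> (x m)) y) * coord (\<xi> (z m)) y' else 0)
       sums matrix_entry (\<Phi> (shift_op x z I)) y y'"
    using ex_infinite_strongly_convergent[OF x(2) rx z(2) rz r] by blast
  have entry: "cmod (matrix_entry (\<Phi> (shift_op x z I)) (f (x n)) (f (z n))) \<ge> \<delta>\<^sup>2 / 2"
    if n: "n \<in> I" for n
  proof -
    define t where "t m = (if m \<in> I then cnj (coord (\<xi> (x m)) (f (x n))) * coord (\<xi> (z m)) (f (z n))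
      else 0)" for m
    define u where "u m = (if m = n then 0 else t m)" for m
    have t: "t sums matrix_entry (\<Phi> (shift_op x z I)) (f (x n)) (f (z n))"
      using I(2)[of "f (x n)" "f (z n)"] unfolding t_def .
    have "(\<lambda>m. t m - (if m = n then t m else 0)) sums
        (matrix_entry (\<Phi> (shift_op x z I)) (f (x n)) (f (z n)) - t n)"
      by (intro sums_diff t sums_single)
    moreover have "(\<lambda>m. t m - (if m = n then t m else 0)) = u" by (auto simp: u_def)
    ultimately have u: "u sums (matrix_entry (\<Phi> (shift_op x z I)) (f (x n)) (f (z n)) - t n)"
      by simp
    have le: "norm (u m) \<le> \<epsilon> m" for m
    proof (cases "m \<in> I \<and> m \<noteq> n")
      case True
      have "cmod (coord (\<xi> (z m)) (f (z n))) \<le> 1"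
        using cmod_coord_le[of "\<xi> (z m)"] norm_xi[OF z(1)] by metis
      moreover have "cmod (coord (\<xi> (x m)) (f (x n))) \<le> \<epsilon> m"
      proof (cases "m < n")
        case True
        \<comment> \<open>The construction bounds the term by the tolerance of the later index; the tolerances decrease.\<close>
        have "\<epsilon> n \<le> \<epsilon> m"
          unfolding \<epsilon>_def using True by (intro mult_left_mono power_decreasing) auto
        thus ?thesis using small(1)[OF True] by linarith
      next
        case False
        with \<open>m \<in> I \<and> m \<noteq> n\<close> have "n < m" by auto
        thus ?thesis using small(2)[of n m] by linarith
      qed
      ultimately have "cmod (coord (\<xi> (x m)) (f (x n))) * cmod (coord (\<xi> (z m)) (f (z n))) \<le> \<epsilon> m * 1"
        using \<epsilon>[of m] by (intro mult_mono) auto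
      thus ?thesis using True by (simp add: u_def t_def norm_mult)
    next
      case False
      thus ?thesis using \<epsilon>[of m] by (auto simp: u_def t_def)
    qed
    have "\<epsilon> sums (\<delta>\<^sup>2 / 4 * (1 / (1 - 1/2)))"
      unfolding \<epsilon>_def by (intro sums_mult geometric_sums) simp
    hence \<epsilon>_sum: "\<epsilon> sums (\<delta>\<^sup>2 / 2)" by simp
    have "norm (suminf u) \<le> suminf \<epsilon>"
      by (rule norm_suminf_le[OF le sums_summable[OF \<epsilon>_sum]])
    hence "cmod (matrix_entry (\<Phi> (shift_op x z I)) (f (x n)) (f (z n)) - t n) \<le> \<delta>\<^sup>2 / 2"
      using sums_unique[OF u] sums_unique[OF \<epsilon>_sum] by simp
    moreover have "cmod (t n) \<ge> \<delta>\<^sup>2"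
      using mult_mono[OF f(2)[OF x(1)[of n]] f(2)[OF z(1)[of n]]] \<open>\<delta> > 0\<close> n
      by (simp add: t_def norm_mult power2_eq_square)
    moreover have "cmod (t n) \<le> cmod (matrix_entry (\<Phi> (shift_op x z I)) (f (x n)) (f (z n)))
        + cmod (matrix_entry (\<Phi> (shift_op x z I)) (f (x n)) (f (z n)) - t n)"
      by (metis norm_triangle_sub norm_minus_commute)
    ultimately show ?thesis by simp
  qed
  have "shift_op x z I \<in> uniform_Roe_algebra X dX"
    by (rule shift_op_in_uniform_Roe_algebra[OF x(2) z(2) rx rz]) (rule r)
  hence "\<Phi> (shift_op x z I) \<in> uniform_Roe_algebra Y dY" by (rule Phi_in)
  moreover have "\<delta>\<^sup>2 / 2 > 0" using \<open>\<delta> > 0\<close> by simp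
  ultimately obtain s where s: "s > 0"
    "\<And>y y'. y \<in> Y \<Longrightarrow> y' \<in> Y \<Longrightarrow> dY y y' > s \<Longrightarrow>
      cmod (matrix_entry (\<Phi> (shift_op x z I)) y y') < \<delta>\<^sup>2 / 2"
    by (rule uniform_Roe_algebra_approx) blast
  obtain n where n: "n \<in> I" "n \<ge> nat \<lceil>s\<rceil>"
    using I(1) unfolding infinite_nat_iff_unbounded_le by blast
  have "dY (f (x n)) (f (z n)) > s" using far[of n] n(2) by linarith
  hence "cmod (matrix_entry (\<Phi> (shift_op x z I)) (f (x n)) (f (z n))) < \<delta>\<^sup>2 / 2"
    by (intro s(2) f(1) x(1) z(1))
  thus False using entry[OF n(1)] by linarith
qed

lemma ex_coarse_map:
  assumes ghosts: "\<forall>S\<subseteq>Y. sparse_space S dY \<longrightarrow> only_compact_ghost_projections S dY"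
  shows "\<exists>f. f \<in> X \<rightarrow> Y \<and> uniformly_finite_to_one X Y f \<and> coarse_map X dX dY f"
proof -
  obtain \<delta> where \<delta>: "\<delta> > 0" "\<forall>p\<in>X. \<exists>y\<in>Y. cmod (coord (\<xi> p) y) \<ge> \<delta>"
    using coord_lower_bound[OF ghosts] by blast
  from bchoice[OF \<delta>(2)[unfolded Bex_def]] obtain f where f: "\<And>p. p \<in> X \<Longrightarrow> f p \<in> Y" "\<And>p. p \<in> X \<Longrightarrow> cmod (coord (\<xi> p) (f p)) \<ge> \<delta>"
    by blast
  have "uniformly_finite_to_one X Y f"
    unfolding uniformly_finite_to_one_def
    by (intro exI[of _ "nat \<lfloor>1 / \<delta>\<^sup>2\<rfloor>"] ballI conjI peak_uniformly_finite_to_one[OF \<delta>(1) f(2)])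
  moreover have "coarse_map X dX dY f" by (rule peak_coarse[OF \<delta>(1) f])
  ultimately show ?thesis using f(1) by blast
qed

end

theorem theorem5p4:
  fixes X :: "'a set" and dX :: "'a \<Rightarrow> 'a \<Rightarrow> real"
    and Y :: "'b set" and dY :: "'b \<Rightarrow> 'b \<Rightarrow> real"
  assumes "Metric_space X dX" and "uniformly_locally_finite X dX"
    and "Metric_space Y dY" and "uniformly_locally_finite Y dY"
    and "\<forall>S\<subseteq>Y. sparse_space S dY \<longrightarrow> only_compact_ghost_projections S dY"
    and "\<exists>\<Phi>. star_embedding (uniform_Roe_algebra X dX) (uniform_Roe_algebra Y dY) \<Phi> \<and>
             rank_preserving (uniform_Roe_algebra X dX) \<Phi>"
  shows "\<exists>f. f \<in> X \<rightarrow> Y \<and> uniformly_finite_to_one X Y f \<and> coarse_map X dX dY f"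
proof (cases "X = {}")
  case True
  thus ?thesis by (auto simp: uniformly_finite_to_one_def coarse_map_def)
next
  case False
  then obtain x0 where "x0 \<in> X" by blast
  obtain \<Phi> where
    hom: "star_homomorphism (uniform_Roe_algebra X dX) (uniform_Roe_algebra Y dY) \<Phi>"
    and rank: "rank_preserving (uniform_Roe_algebra X dX) \<Phi>"
    using assms(6) unfolding star_embedding_def by blast
  have "Roe_homomorphism X dX Y dY \<Phi>" by (rule Roe_homomorphism.intro[OF assms(1-4) hom])
  then obtain \<xi> where "implemented_embedding X dX Y dY \<Phi> \<xi>"
    using Roe_homomorphism.ex_implementation[OF _ rank \<open>x0 \<in> X\<close>] by blast
  thus ?thesis using implemented_embedding.ex_coarse_map assms(5) by blast
qed

end
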